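(* Let $V$ be a $d'$-dimensional irreducible $\triangle_q$-module that has a marginal weight. Then there exists $(a,b,c,\lambda,\delta)\in(\mathbb F^\times)^4\times\mathbb F$ such that the $\triangle_q$-module $W_\lambda^\delta(a,b,c)$ is isomorphic to $V$.
   Context: $\mathbb F$ is an algebraically closed field and $q\in\mathbb F^\times$ is a root of unity of order $d$ with $d\notin\{1,2,4\}$. Put $d'=d$ if $d$ is odd and $d'=d/2$ if $d$ is even (the order of $q^2$). The universal Askey–Wilson algebra $\triangle_q$ is the unital associative $\mathbb F$-algebra with generators $A,B,C$ subject to the relations that each of $A+\frac{qBC-q^{-1}CB}{q^2-q^{-2}}$, $B+\frac{qCA-q^{-1}AC}{q^2-q^{-2}}$, $C+\frac{qAB-q^{-1}BA}{q^2-q^{-2}}$ is central; let $\alpha,\beta,\gamma$ be these three central elements multiplied by $q+q^{-1}$. For a $\triangle_q$-module $V$ and $\mu\in\mathbb F^\times$ let $V(\mu)=\{v\in V: Bv=(\mu+\mu^{-1})v\}$; $\mu$ is a weight of $V$ if $V(\mu)\ne0$. A weight $\mu$ is marginal if there is a nonzero $v\in V(\mu)$ with $(B-\mu q^2-\mu^{-1}q^{-2})(B-\mu-\mu^{-1})Av=0$. For $(a,b,c,\lambda)\in(\mathbb F^\times)^4$ and $i\in\mathbb N$ set $\theta_i=a\lambda^{-1}q^{2i}+a^{-1}\lambda q^{-2i}$, $\theta_i^*=b\lambda^{-1}q^{2i}+b^{-1}\lambda q^{-2i}$, $\varphi_i=a^{-1}b^{-1}\lambda q(q^i-q^{-i})(\lambda^{-1}q^{i-1}-\lambda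 q^{1-i})(q^{-i}-abc\lambda^{-1}q^{i-1})(q^{-i}-abc^{-1}\lambda^{-1}q^{i-1})$. The Verma module $M_\lambda(a,b,c)$ is the $\triangle_q$-module with basis $\{m_i\}_{i\in\mathbb N}$ with $(A-\theta_i)m_i=m_{i+1}$, $(B-\theta_i^* )m_i=\varphi_im_{i-1}$ ($m_{-1}$ arbitrary), and $\alpha,\beta,\gamma$ acting as the scalars $(b+b^{-1})(c+c^{-1})+(a+a^{-1})(\lambda q+\lambda^{-1}q^{-1})$, $(c+c^{-1})(a+a^{-1})+(b+b^{-1})(\lambda q+\lambda^{-1}q^{-1})$, $(a+a^{-1})(b+b^{-1})+(c+c^{-1})(\lambda q+\lambda^{-1}q^{-1})$. For $\delta\in\mathbb F$ the span $O_\lambda^\delta(a,b,c)$ of $\{\delta m_i-m_{d'+i}\}_{i\in\mathbb N}$ is a submodule and $W_\lambda^\delta(a,b,c):=M_\lambda(a,b,c)/O_\lambda^\delta(a,b,c)$, a $d'$-dimensional $\triangle_q$-module. *)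

theory Defs
  imports "HOL-Computational_Algebra.Polynomial"
begin

text \<open>A module over the universal Askey--Wilson algebra is an 'a-vector space
  (given by a scalar multiplication sc on the type 'v) together with three linear
  maps A, B, C such that the three elements
  A + (qBC - q^-1 CB)/(q^2-q^-2) etc. commute with A, B, C (hence are central,
  as A, B, C generate the algebra).\<close>

definition aw_central_A :: "('a::field \<Rightarrow> 'v::ab_group_add \<Rightarrow> 'v) \<Rightarrow> 'a \<Rightarrow>
    ('v \<Rightarrow> 'v) \<Rightarrow> ('v \<Rightarrow> 'v) \<Rightarrow> ('v \<Rightarrow> 'v) \<Rightarrow> 'v \<Rightarrow> 'v" where
  "aw_central_A sc q A B C = (\<lambda>v. A v + sc (inverse (q^2 - inverse q ^ 2))
      (sc q (B (C v)) - sc (inverse q) (C (B v))))"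

definition aw_module :: "('a::field \<Rightarrow> 'v::ab_group_add \<Rightarrow> 'v) \<Rightarrow> 'a \<Rightarrow>
    ('v \<Rightarrow> 'v) \<Rightarrow> ('v \<Rightarrow> 'v) \<Rightarrow> ('v \<Rightarrow> 'v) \<Rightarrow> bool" where
  "aw_module sc q A B C \<longleftrightarrow>
     vector_space sc \<and> Vector_Spaces.linear sc sc A \<and> Vector_Spaces.linear sc sc B \<and> Vector_Spaces.linear sc sc C \<and>
     (\<forall>Z \<in> {aw_central_A sc q A B C, aw_central_A sc q B C A, aw_central_A sc q C A B}.
        \<forall>X \<in> {A, B, C}. Z \<circ> X = X \<circ> Z)"

definition aw_irreducible :: "('a::field \<Rightarrow> 'v::ab_group_add \<Rightarrow> 'v) \<Rightarrow>
    ('v \<Rightarrow> 'v) \<Rightarrow> ('v \<Rightarrow> 'v) \<Rightarrow> ('v \<Rightarrow> 'v) \<Rightarrow> bool" where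
  "aw_irreducible sc A B C \<longleftrightarrow> (UNIV :: 'v set) \<noteq> {0} \<and>
     (\<forall>W. module.subspace sc W \<and> A ` W \<subseteq> W \<and> B ` W \<subseteq> W \<and> C ` W \<subseteq> W
          \<longrightarrow> W = {0} \<or> W = UNIV)"

definition aw_marginal_weight :: "('a::field \<Rightarrow> 'v::ab_group_add \<Rightarrow> 'v) \<Rightarrow> 'a \<Rightarrow>
    ('v \<Rightarrow> 'v) \<Rightarrow> ('v \<Rightarrow> 'v) \<Rightarrow> 'a \<Rightarrow> bool" where
  "aw_marginal_weight sc q A B \<mu> \<longleftrightarrow> \<mu> \<noteq> 0 \<and>
     (\<exists>v. v \<noteq> 0 \<and> B v = sc (\<mu> + inverse \<mu>) v \<and>
        (let w = B (A v) - sc (\<mu> + inverse \<mu>) (A v)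
         in B w - sc (\<mu> * q^2 + inverse \<mu> * inverse q ^ 2) w = 0))"

text \<open>The Verma module M_lambda(a,b,c) is realised on finitely supported
  coefficient sequences x :: nat => 'a, x = sum x_i m_i.\<close>

definition verma_space :: "(nat \<Rightarrow> 'a::zero) set" where
  "verma_space = {x. finite {i. x i \<noteq> 0}}"

definition aw_theta :: "'a::field \<Rightarrow> 'a \<Rightarrow> 'a \<Rightarrow> nat \<Rightarrow> 'a" where
  "aw_theta q a lam i = a * inverse lam * q^(2*i) + inverse a * lam * inverse q ^ (2*i)"

definition aw_phi :: "'a::field \<Rightarrow> 'a \<Rightarrow> 'a \<Rightarrow> 'a \<Rightarrow> 'a \<Rightarrow> nat \<Rightarrow> 'a" where
  "aw_phi q a b c lam i = inverse a * inverse b * lam * q * (q^i - inverse q ^ i) *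
     (inverse lam * (q powi (int i - 1)) - lam * (q powi (1 - int i))) *
     (inverse q ^ i - a * b * c * inverse lam * (q powi (int i - 1))) *
     (inverse q ^ i - a * b * inverse c * inverse lam * (q powi (int i - 1)))"

text \<open>(A - theta_i) m_i = m_(i+1)\<close>
definition verma_A :: "'a::field \<Rightarrow> 'a \<Rightarrow> 'a \<Rightarrow> 'a \<Rightarrow> 'a \<Rightarrow> (nat \<Rightarrow> 'a) \<Rightarrow> (nat \<Rightarrow> 'a)" where
  "verma_A q a b c lam x = (\<lambda>i. aw_theta q a lam i * x i + (if i = 0 then 0 else x (i - 1)))"

text \<open>(B - theta*_i) m_i = phi_i m_(i-1)\<close>
definition verma_B :: "'a::field \<Rightarrow> 'a \<Rightarrow> 'a \<Rightarrow> 'a \<Rightarrow> 'a \<Rightarrow> (nat \<Rightarrow> 'a) \<Rightarrow> (nat \<Rightarrow> 'a)" where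
  "verma_B q a b c lam x = (\<lambda>i. aw_theta q b lam i * x i + aw_phi q a b c lam (Suc i) * x (Suc i))"

definition verma_gamma :: "'a::field \<Rightarrow> 'a \<Rightarrow> 'a \<Rightarrow> 'a \<Rightarrow> 'a \<Rightarrow> 'a" where
  "verma_gamma q a b c lam = (a + inverse a) * (b + inverse b) +
     (c + inverse c) * (lam * q + inverse lam * inverse q)"

text \<open>C is determined by gamma: gamma/(q+q^-1) = C + (qAB - q^-1 BA)/(q^2-q^-2).\<close>
definition verma_C :: "'a::field \<Rightarrow> 'a \<Rightarrow> 'a \<Rightarrow> 'a \<Rightarrow> 'a \<Rightarrow> (nat \<Rightarrow> 'a) \<Rightarrow> (nat \<Rightarrow> 'a)" where
  "verma_C q a b c lam x = (\<lambda>i.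
     verma_gamma q a b c lam * inverse (q + inverse q) * x i
     - inverse (q^2 - inverse q ^ 2) *
       (q * verma_A q a b c lam (verma_B q a b c lam x) i
        - inverse q * verma_B q a b c lam (verma_A q a b c lam x) i))"

definition verma_O :: "nat \<Rightarrow> 'a::field \<Rightarrow> (nat \<Rightarrow> 'a) set" where
  "verma_O d' \<delta> = {x. \<exists>N (k :: nat \<Rightarrow> 'a). x = (\<lambda>j. \<Sum>i<N. k i *
       ((if j = i then \<delta> else 0) - (if j = d' + i then 1 else 0)))}"

text \<open>W^delta_lambda(a,b,c) = M/O is isomorphic to V iff there is a surjective
  module homomorphism M -> V with kernel O (first isomorphism theorem).\<close>
definition W_iso :: "('a::field \<Rightarrow> 'v::ab_group_add \<Rightarrow> 'v) \<Rightarrow> 'a \<Rightarrow> nat \<Rightarrow>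
    ('v \<Rightarrow> 'v) \<Rightarrow> ('v \<Rightarrow> 'v) \<Rightarrow> ('v \<Rightarrow> 'v) \<Rightarrow> 'a \<Rightarrow> 'a \<Rightarrow> 'a \<Rightarrow> 'a \<Rightarrow> 'a \<Rightarrow> bool" where
  "W_iso sc q d' A B C a b c lam \<delta> \<longleftrightarrow>
    (\<exists>f :: (nat \<Rightarrow> 'a) \<Rightarrow> 'v.
       (\<forall>x \<in> verma_space. \<forall>y \<in> verma_space. f (\<lambda>i. x i + y i) = f x + f y) \<and>
       (\<forall>x \<in> verma_space. \<forall>t. f (\<lambda>i. t * x i) = sc t (f x)) \<and>
       (\<forall>x \<in> verma_space. f (verma_A q a b c lam x) = A (f x)) \<and>
       (\<forall>x \<in> verma_space. f (verma_B q a b c lam x) = B (f x)) \<and>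
       (\<forall>x \<in> verma_space. f (verma_C q a b c lam x) = C (f x)) \<and>
       f ` verma_space = UNIV \<and>
       {x \<in> verma_space. f x = 0} = verma_O d' \<delta>)"

end

theory Submission
  imports Defs
begin

text \<open>
  By Schur's lemma the three central elements act on V as scalars, and eliminating C leaves two
  cubic relations between A and B. Put th(x) = x + 1/x. On a vector v of weight mu the first relation reads
  (B - th(mu q^2))(B - th(mu q^-2)) A v = const * v; comparing it with marginality gives a weight
  vector v with (B - th(mu q^2)) A v = k v, directly when mu^2 is not q^2, and as an eigenvector of
  (B - th(mu q^2)) A on V(mu) otherwise.

  Set lambda = b / mu. That the scalars alpha, beta, gamma and the number k are those of a Verma
  module is a system of equations for a + 1/a, b, c + 1/c; eliminating the first and the last
  unknown leaves a cubic equation, which is solvable over an algebraically closed field.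
  The second relation then shows by induction that the vectors (A - theta_(i-1))...(A - theta_0) v satisfy the
  Verma relations. They span V by irreducibility, and the product of (A - theta_j) over one period
  commutes with A, B and C, hence is a scalar delta. The kernel of the resulting map is O by comparison
  of dimensions.
\<close>

section \<open>Solving for the parameters\<close>

lemma quadratic_roots_exist:
  fixes s m :: "'a::alg_closed_field"
  shows "\<exists>x z. x + z = s \<and> x * z = m"
proof -
  have "degree [:m, - s, 1:] > 0"
    by simp
  then obtain x where "poly [:m, - s, 1:] x = 0"
    using alg_closed_imp_poly_has_root by blast
  then have "x * (s - x) = m"
    by (simp add: algebra_simps)
  then show ?thesis
    by (intro exI[of _ x] exI[of _ "s - x"]) simp
qed

lemma sum_with_inverse_exists:
  fixes x :: "'a::alg_closed_field"
  shows "\<exists>a a'. a * a' = 1 \<and> a + a' = x"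
  using quadratic_roots_exist[of x 1] by blast

lemma square_root_exists:
  fixes x :: "'a::alg_closed_field"
  shows "\<exists>y. y\<^sup>2 = x"
  using nth_root_exists[of 2 x] by auto

lemma cubic_root_exists:
  fixes c0 c1 c2 c3 :: "'a::alg_closed_field"
  assumes "c3 \<noteq> 0"
  shows "\<exists>s. c0 + c1 * s + c2 * s^2 + c3 * s^3 = 0"
proof -
  have "degree [:c0, c1, c2, c3:] > 0"
    using assms by simp
  then obtain s where "poly [:c0, c1, c2, c3:] s = 0"
    using alg_closed_imp_poly_has_root by blast
  then show ?thesis
    by (intro exI[of _ s]) (simp add: algebra_simps power2_eq_square power3_eq_cube)
qed

text \<open>With \<open>nu\<^sup>2 = mu / q\<close> and \<open>b = nu t\<close>, the two factors below are \<open>b + 1/b\<close> and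
  \<open>lambda q + 1/(lambda q)\<close>, and \<open>x\<close>, \<open>z\<close> are \<open>a + 1/a\<close>, \<open>c + 1/c\<close>. Solving the first and last equation
  for \<open>x\<close>, \<open>z\<close> turns the middle one into a cubic equation for \<open>S = t\<^sup>2 + 1/t\<^sup>2\<close>.\<close>

lemma scalars_solvable_generic:
  fixes nu nu' al be ga :: "'a::alg_closed_field"
  assumes nu: "nu * nu' = 1" and ne: "nu^2 \<noteq> nu'^2"
  shows "\<exists>t t' x z. t * t' = 1 \<and>
    al = (nu * t + nu' * t') * z + x * (t * nu' + t' * nu) \<and>
    be = z * x + (nu * t + nu' * t') * (t * nu' + t' * nu) \<and>
    ga = x * (nu * t + nu' * t') + z * (t * nu' + t' * nu)"
proof -
  define N where "N = nu^2 + nu'^2"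
  have "N^2 - 4 = (nu^2 - nu'^2)^2"
    unfolding N_def using nu by algebra
  then have N4: "N^2 - 4 \<noteq> 0"
    using ne by simp
  define c0 where "c0 = - 4 * (be - N) * (N^2 - 4) - 4 * al * ga + (al^2 + ga^2) * N"
  define c1 where "c1 = 4 * (N^2 - 4) - al * ga * N + (al^2 + ga^2)"
  define c2 where "c2 = (be - N) * (N^2 - 4)"
  \<comment> \<open>The leading coefficient is nonzero because \<open>nu^2\<close> and
    \<open>nu'^2\<close> differ.\<close>
  obtain S where S0: "c0 + c1 * S + c2 * S^2 + (- (N^2 - 4)) * S^3 = 0"
    using cubic_root_exists[of "- (N^2 - 4)" c0 c1 c2] N4 by fastforce
  then have S: "(be - S - N) * (S^2 - 4) * (N^2 - 4) = al * ga * (S * N + 4) - (al^2 + ga^2) * (S + N)"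
    unfolding c0_def c1_def c2_def by algebra
  obtain u u' where u: "u * u' = 1" "u + u' = S"
    using sum_with_inverse_exists by blast
  obtain t where t: "t^2 = u"
    using square_root_exists by blast
  define t' where "t' = t * u'"
  have tt: "t * t' = 1"
    unfolding t'_def using u(1) t[symmetric] by (simp add: power2_eq_square mult.assoc)
  have t'2: "t'^2 = u'"
    unfolding t'_def power_mult_distrib t using u(1) by algebra
  have SS: "S = t^2 + t'^2"
    using u t t'2 by simp
  define y where "y = nu * t + nu' * t'"
  define w where "w = t * nu' + t' * nu"
  have yw: "y * w = S + N"
    unfolding y_def w_def SS N_def using tt nu by algebra
  have yyww: "y^2 + w^2 = S * N + 4"
    unfolding y_def w_def SS N_def using tt nu by algebra
  have D: "(y^2 - w^2)^2 = (S^2 - 4) * (N^2 - 4)"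
    unfolding y_def w_def SS N_def using tt nu by algebra
  have "\<exists>x z. al = y * z + x * w \<and> be = z * x + y * w \<and> ga = x * y + z * w"
  \<comment> \<open>The first and last equations are linear in \<open>x\<close> and \<open>z\<close>
    with determinant \<open>y^2 - w^2\<close> up to sign. If it is nonzero, Cramer's rule applies,
    and the middle equation times the squared determinant is the equation for
    \<open>S\<close>.\<close>
  proof (cases "y^2 = w^2")
    case False
    define x where "x = (ga * y - al * w) / (y^2 - w^2)"
    define z where "z = (al * y - ga * w) / (y^2 - w^2)"
    have x: "x * (y^2 - w^2) = ga * y - al * w" and z: "z * (y^2 - w^2) = al * y - ga * w"
      using False by (simp_all add: x_def z_def)
    have "(y^2 - w^2) * (al - (y * z + x * w)) = 0"
      using x z by algebra
    moreover have "(y^2 - w^2) * (ga - (x * y + z * w)) = 0"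
      using x z by algebra
    moreover have "(y^2 - w^2)^2 * (be - (z * x + y * w)) = 0"
      using x z S yw yyww D by algebra
    ultimately have "al = y * z + x * w \<and> be = z * x + y * w \<and> ga = x * y + z * w"
      using False by auto
    then show ?thesis
      by blast
  next
    case True
    then have S4: "S^2 - 4 = 0"
      using D N4 by auto
    \<comment> \<open>If \<open>y\<close> and \<open>w\<close> both vanished, then
      \<open>S = - N\<close> and \<open>S * N = - 4\<close>, hence \<open>N^2 = 4\<close>.\<close>
    have y0: "y \<noteq> 0"
    proof
      assume "y = 0"
      then have "w = 0" using True by simp
      then have "S + N = 0" "S * N + 4 = 0" using yw yyww \<open>y = 0\<close> by simp_all
      then have "N^2 - 4 = 0" by algebra
      then show False using N4 by simp
    qed
    consider "w = y" | "w = - y"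
      using True power2_eq_iff by metis
    then show ?thesis
    proof cases
      case 1
      \<comment> \<open>At \<open>S^2 = 4\<close> the equation for \<open>S\<close> collapses to the
        consistency of the two linear equations; what remains prescribes the sum and the product of
        \<open>x\<close> and \<open>z\<close>.\<close>
      have "y^2 * (al - ga)^2 = 0"
        using S S4 yw yyww 1 by algebra
      then have "al = ga" using y0 by simp
      obtain x z where "x + z = al / y" "x * z = be - y^2"
        using quadratic_roots_exist by blast
      then have "y * (x + z) = al" "be = z * x + y * y"
        using y0 by (simp_all add: power2_eq_square algebra_simps)
      then show ?thesis
        using 1 \<open>al = ga\<close> by (intro exI[of _ x] exI[of _ z]) (simp add: algebra_simps)
    next
      case 2
      have "y^2 * (al + ga)^2 = 0"
        using S S4 yw yyww 2 by algebra
      then have "ga = - al" using y0 by (simp add: add_eq_0_iff)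
      obtain x' z where "x' + z = al / y" "x' * z = - (be + y^2)"
        using quadratic_roots_exist by blast
      then have "y * (x' + z) = al" and "be = z * (- x') - y * y"
        using y0 by (simp, algebra)
      then show ?thesis
        using 2 \<open>ga = - al\<close> by (intro exI[of _ "- x'"] exI[of _ z]) (simp add: algebra_simps)
    qed
  qed
  then show ?thesis
    unfolding y_def w_def using tt by blast
qed

text \<open>The first factor is \<open>theta_0 (theta*_0 - theta*_1) + phi_1\<close> for \<open>lambda = b / mu\<close>: when
  \<open>mu\<^sup>2\<close> is not \<open>q\<^sup>2\<close>, it is determined by alpha and gamma.\<close>

lemma raising_defect_generic:
  fixes a a' b b' mu mu' q q' z :: "'a::field"
  assumes "a * a' = 1" "b * b' = 1" "mu * mu' = 1" "q * q' = 1"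
  shows "((a * b' * mu + a' * b * mu') * (mu + mu' - mu * q^2 - mu' * q'^2) +
      (q - q') * (b' * mu - b * mu') * (q' * mu' * a' - z + q * a * mu)) * (mu + mu' - mu * q'^2 - mu' * q^2)
    = (q - q')^2 * ((q + q') * ((b + b') * z + (a + a') * (b * mu' * q + b' * mu * q'))
        - ((a + a') * (b + b') + z * (b * mu' * q + b' * mu * q')) * (mu + mu'))"
  using assms by algebra

text \<open>The case \<open>mu = e q\<close>, \<open>e\<^sup>2 = 1\<close>, with \<open>z\<close> standing for \<open>e (c + 1/c)\<close>. Here alpha is
  \<open>e gamma\<close>, but \<open>k\<close> is a further datum. The unknown of the cubic equation is \<open>Y = (b + 1/b)\<^sup>2\<close>.\<close>

lemma scalars_solvable_special:
  fixes q q' ga be k :: "'a::alg_closed_field"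
  assumes q: "q * q' = 1" and ne: "q + q' \<noteq> 0" "q - q' \<noteq> 0"
  shows "\<exists>b b' x z. b * b' = 1 \<and> ga = (b + b') * (x + z) \<and>
    be = x * z + (b + b')^2 \<and> k = x * (q' * b' - q * b) - z * (q * b' - q' * b)"
proof -
  define Q where "Q = (q + q')^2"
  define R where "R = q - q'"
  have QR: "R^2 = Q - 4"
    unfolding Q_def R_def using q by algebra
  have Q0: "Q \<noteq> 0" "R \<noteq> 0"
    using ne by (simp_all add: Q_def R_def)
  obtain Y where "- Q * ga^2 + (4 * be * Q + ga^2 - R * k * ga - k^2) * Y
      + (- Q * (be + 4)) * Y^2 + Q * Y^3 = 0"
    using cubic_root_exists Q0(1) by metis
  then have Y: "(be - Y) * Q * (Y - 4) * Y = (Y - Q) * ga^2 - R * k * ga * Y - k^2 * Y"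
    by algebra
  \<comment> \<open>In the third case the equations for \<open>ga\<close> and \<open>k\<close> are
    solved linearly for \<open>x\<close> and \<open>z\<close>. This system degenerates if
    \<open>b + 1/b = 0\<close> (\<open>Y = 0\<close>) or \<open>b = 1/b\<close>
    (\<open>Y = 4\<close>); in characteristic 2 the two coincide.\<close>
  consider "Y = 0" | "Y \<noteq> 0" "Y = 4" | "Y \<noteq> 0" "Y \<noteq> 4"
    by blast
  then show ?thesis
  proof cases
    case 1
    then have "ga = 0"
      using Y Q0 by simp
    obtain b :: 'a where b: "b^2 = - 1"
      using square_root_exists by blast
    have b0: "b \<noteq> 0"
      using b by auto
    define p where "p = - b * (q + q')"
    have p0: "p \<noteq> 0"
      using b0 ne by (simp add: p_def)
    obtain x z' where xz: "x + z' = k / p" "x * z' = - be"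
      using quadratic_roots_exist by blast
    have "k = p * (x + z')"
      unfolding xz(1) using p0 by simp
    also have "\<dots> = x * (q' * (- b) - q * b) - (- z') * (q * (- b) - q' * b)"
      by (simp add: p_def algebra_simps)
    finally show ?thesis
      using b xz(2) \<open>ga = 0\<close>
      by (intro exI[of _ b] exI[of _ "- b"] exI[of _ x] exI[of _ "- z'"]) (simp add: power2_eq_square)
  next
    case 2
    \<comment> \<open>At \<open>Y = 4\<close> the cubic equation becomes a perfect square, which
      ties \<open>k\<close> to \<open>ga\<close>.\<close>
    have "(R * ga + 2 * k)^2 = 0"
      using Y QR unfolding \<open>Y = 4\<close> by algebra
    then have k: "R * ga + 2 * k = 0"
      by simp
    have two: "(2::'a) \<noteq> 0"
    proof
      assume "(2::'a) = 0"
      moreover have "(4::'a) = 2 * 2"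
        by simp
      ultimately have "(4::'a) = 0"
        by (simp only: mult_zero_left)
      then show False
        using 2 by simp
    qed
    obtain x z where xz: "x + z = ga / 2" "x * z = be - 4"
      using quadratic_roots_exist by blast
    have g: "ga = 2 * (x + z)"
      unfolding xz(1) using two by simp
    have "2 * (k - (x * (q' - q) - z * (q - q'))) = 0"
      using k unfolding g R_def by algebra
    then have "k = x * (q' - q) - z * (q - q')"
      unfolding mult_eq_0_iff using two by simp
    then show ?thesis
      using xz(2) g
      by (intro exI[of _ 1] exI[of _ 1] exI[of _ x] exI[of _ z]) simp
  next
    case 3
    obtain y where y: "y^2 = Y"
      using square_root_exists by blast
    obtain b b' where b: "b * b' = 1" "b + b' = y"
      using sum_with_inverse_exists by blast
    have y0: "y \<noteq> 0"
      using 3 y by auto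
    have u2: "(b' - b)^2 = Y - 4"
      unfolding y[symmetric] b(2)[symmetric] using b(1) by algebra
    \<comment> \<open>Now \<open>x + z = s\<close> and \<open>k = x * p - z * r\<close> are linear
      equations with determinant \<open>p + r\<close> up to sign; eliminating \<open>x\<close> and
      \<open>z\<close> from the equation for \<open>be\<close> leaves the cubic for
      \<open>Y\<close>.\<close>
    define p where "p = q' * b' - q * b"
    define r where "r = q * b' - q' * b"
    define s where "s = ga / y"
    have s: "ga = s * y"
      using y0 by (simp add: s_def)
    have ppr: "(p + r)^2 = Q * (Y - 4)"
      unfolding u2[symmetric] p_def r_def Q_def by algebra
    have pr: "p * r = Y - Q"
      unfolding y[symmetric] b(2)[symmetric] p_def r_def Q_def using b(1) q by algebra
    have pmr: "p - r = - R * y"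
      unfolding b(2)[symmetric] p_def r_def R_def by algebra
    have ppr0: "p + r \<noteq> 0"
      using ppr 3 Q0 by auto
    define x where "x = (k + r * s) / (p + r)"
    define z where "z = (p * s - k) / (p + r)"
    have x: "x * (p + r) = k + r * s" and z: "z * (p + r) = p * s - k"
      using ppr0 by (simp_all add: x_def z_def)
    have "(p + r) * (x + z - s) = 0"
      using x z by algebra
    then have "x + z = s"
      using ppr0 by simp
    have "(p + r) * (k - (x * p - z * r)) = 0"
      using x z by algebra
    then have k: "k = x * p - z * r"
      using ppr0 by simp
    have "y^2 * (p + r)^2 * (be - (x * z + y^2)) = 0"
    proof -
      have "x * z * (p + r)^2 = (k + r * s) * (p * s - k)"
        using x z by algebra
      also have "\<dots> = p * r * s^2 + k * s * (p - r) - k^2"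
        by algebra
      also have "\<dots> = (Y - Q) * s^2 - k * s * R * y - k^2"
        unfolding pr pmr by algebra
      finally have "y^2 * (x * z * (p + r)^2) = (Y - Q) * ga^2 - R * k * ga * y^2 - k^2 * y^2"
        unfolding s by algebra
      also have "\<dots> = (be - Y) * Q * (Y - 4) * Y"
        unfolding Y y by simp
      also have "\<dots> = y^2 * (p + r)^2 * (be - y^2)"
        unfolding ppr y by algebra
      finally show ?thesis
        by algebra
    qed
    then have "be = x * z + y^2"
      using y0 ppr0 by simp
    then show ?thesis
      using k b \<open>x + z = s\<close> s unfolding p_def r_def
      by (intro exI[of _ b] exI[of _ b'] exI[of _ x] exI[of _ z]) (simp add: mult.commute)
  qed
qed

text \<open>For \<open>mu = e * q\<close> the value of \<open>k\<close> required by the Verma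
  relations has the factor \<open>q - q'\<close>; the cofactor is the linear form prescribed in
  \<open>scalars_solvable_special\<close>.\<close>

lemma raising_defect_special:
  fixes a a' b b' e q q' z :: "'a::field"
  assumes "a * a' = 1" "b * b' = 1" "e * e = 1" "q * q' = 1" 
  shows "(a * b' * (e * q) + a' * b * (e * q')) * (e * q + e * q' - e * q * q^2 - e * q' * q'^2) +
      (q - q') * (b' * (e * q) - b * (e * q')) * (q' * (e * q') * a' - e * z + q * a * (e * q))
    = (q - q') * ((a + a') * (q' * b' - q * b) - z * (q * b' - q' * b))"
  using assms by algebra

text \<open>The next two identities are in the variables \<open>u = a / lambda\<close>, \<open>s = b / lambda\<close>, \<open>X = q^n\<close>
  and their inverses.\<close>

lemma phi_recurrence_identity:
  fixes u s b q u' s' b' q' X X' z :: "'a::field"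
  assumes "u * u' = 1" "s * s' = 1" "b * b' = 1" "q * q' = 1" "X * X' = 1"
  defines "th \<equiv> \<lambda>X X'. u * X^2 + u' * X'^2"
  defines "ts \<equiv> \<lambda>X X'. s * X^2 + s' * X'^2"
  defines "ph \<equiv> \<lambda>X X'. (X - X') * (s * b' * q' * X - s' * b * q * X') * (u' * b' * q * X'^2 + u * b * q' * X^2 - z)"
  shows "ts X X' * (th X X' + th (q*X) (q'*X')) + ph X X'
      - (q^2 + q'^2) * (ts (q*X) (q'*X') * th (q*X) (q'*X') + ph (q*X) (q'*X') + th X X' * ts X X')
      + ph (q^2*X) (q'^2*X') + ts (q*X) (q'*X') * (th X X' + th (q*X) (q'*X'))
     = - ((q - q')^2 * ((u * s' * b + u' * s * b') * (b + b') + z * (s' * b * q + s * b' * q')))"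
  unfolding th_def ts_def ph_def using assms(1-5) by algebra

lemma phi_theta_identity:
  fixes u s b q u' s' b' q' X X' z :: "'a::field"
  assumes "u * u' = 1" "s * s' = 1" "b * b' = 1" "q * q' = 1" "X * X' = 1"
  defines "th \<equiv> \<lambda>X X'. u * X^2 + u' * X'^2"
  defines "ts \<equiv> \<lambda>X X'. s * X^2 + s' * X'^2"
  defines "ph \<equiv> \<lambda>X X'. (X - X') * (s * b' * q' * X - s' * b * q * X') * (u' * b' * q * X'^2 + u * b * q' * X^2 - z)"
  shows "2 * ts X X' * (th X X')^2 - (q^2 + q'^2) * (th X X')^2 * ts X X' + (q^2 - q'^2)^2 * ts X X'
      + ph X X' * (th X X' - th (q*X) (q'*X')) + ph (q*X) (q'*X') * (th X X' - th (q'*X) (q*X'))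
     = (q - q')^2 * ((q + q') * (z * (u * s' * b + u' * s * b') + (b + b') * (s' * b * q + s * b' * q'))
         - ((u * s' * b + u' * s * b') * (b + b') + z * (s' * b * q + s * b' * q')) * th X X')"
  unfolding th_def ts_def ph_def using assms(1-5) by algebra

text \<open>The factor of \<open>k\<close> in the hypothesis vanishes precisely when
  \<open>mu^2 = q^2\<close>. Otherwise \<open>k\<close> is determined, and only the three scalars
  have to be matched; in the exceptional case the hypothesis ties \<open>al\<close> to
  \<open>ga\<close>, and \<open>k\<close> is matched separately.\<close>

lemma verma_parameters_exist:
  fixes q q' mu mu' al be ga k :: "'a::alg_closed_field"
  assumes q: "q * q' = 1" "q + q' \<noteq> 0" "q - q' \<noteq> 0" and mu: "mu * mu' = 1"
    and k: "k * (mu + mu' - mu * q'^2 - mu' * q^2) = (q - q')^2 * ((q + q') * al - ga * (mu + mu'))"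
  shows "\<exists>a a' b b' c c'. a * a' = 1 \<and> b * b' = 1 \<and> c * c' = 1 \<and>
    al = (b + b') * (c + c') + (a + a') * (b * mu' * q + b' * mu * q') \<and>
    be = (c + c') * (a + a') + (b + b') * (b * mu' * q + b' * mu * q') \<and>
    ga = (a + a') * (b + b') + (c + c') * (b * mu' * q + b' * mu * q') \<and>
    k = (a * b' * mu + a' * b * mu') * (mu + mu' - mu * q^2 - mu' * q'^2) +
      (q - q') * (b' * mu - b * mu') * (q' * mu' * a' - (c + c') + q * a * mu)"
    (is "\<exists>a a' b b' c c'. ?P a a' b b' c c'")
proof (cases "mu * q' = mu' * q")
  case False
  have D: "mu + mu' - mu * q'^2 - mu' * q^2 = (mu * q' - mu' * q) * (q - q')"
    using q(1) by algebra
  then have D0: "mu + mu' - mu * q'^2 - mu' * q^2 \<noteq> 0"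
    using False q by simp
  \<comment> \<open>For \<open>b = nu * t\<close> the square root turns \<open>b * mu' * q\<close>
    into \<open>t * nu'\<close>, which gives the system of
    \<open>scalars_solvable_generic\<close>.\<close>
  obtain nu where nu2: "nu^2 = mu * q'"
    using square_root_exists by blast
  have "nu \<noteq> 0"
    using nu2 mu q by auto
  define nu' where "nu' = inverse nu"
  have nu: "nu * nu' = 1"
    using \<open>nu \<noteq> 0\<close> by (simp add: nu'_def)
  have "nu'^2 = nu'^2 * (nu^2 * (mu' * q))"
    unfolding nu2 using q(1) mu by algebra
  also have "\<dots> = mu' * q"
    using nu by algebra
  finally have nu'2: "nu'^2 = mu' * q" .
  obtain t t' x z where tt: "t * t' = 1"
    and al: "al = (nu * t + nu' * t') * z + x * (t * nu' + t' * nu)"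
    and be: "be = z * x + (nu * t + nu' * t') * (t * nu' + t' * nu)"
    and ga: "ga = x * (nu * t + nu' * t') + z * (t * nu' + t' * nu)"
    using scalars_solvable_generic[OF nu, of al be ga] False nu2 nu'2 by metis
  obtain a a' c c' where a: "a * a' = 1" "a + a' = x" and c: "c * c' = 1" "c + c' = z"
    using sum_with_inverse_exists by metis
  define b b' where "b = nu * t" and "b' = nu' * t'"
  have b: "b * b' = 1"
    unfolding b_def b'_def using nu tt by algebra
  have w: "t * nu' + t' * nu = b * mu' * q + b' * mu * q'"
  proof -
    have "b * (mu' * q) = t * nu'" "b' * (mu * q') = t' * nu"
      unfolding nu2[symmetric] nu'2[symmetric] b_def b'_def using nu by algebra+
    then show ?thesis
      by (simp add: mult.assoc)
  qed
  note eqs = al[folded b_def b'_def, unfolded w, folded a c] be[folded b_def b'_def, unfolded w, folded a c]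
    ga[folded b_def b'_def, unfolded w, folded a c]
  let ?k = "(a * b' * mu + a' * b * mu') * (mu + mu' - mu * q^2 - mu' * q'^2) +
      (q - q') * (b' * mu - b * mu') * (q' * mu' * a' - (c + c') + q * a * mu)"
  have "k * (mu + mu' - mu * q'^2 - mu' * q^2) = ?k * (mu + mu' - mu * q'^2 - mu' * q^2)"
    unfolding k raising_defect_generic[OF a(1) b mu q(1)] eqs(1,3) ..
  then have "k = ?k"
    using D0 by simp
  then have "?P a a' b b' c c'"
    using a(1) b c(1) eqs by blast
  then show ?thesis
    by blast
next
  case True
  \<comment> \<open>A square root of 1. Since \<open>mu + mu' = e * (q + q')\<close>, the hypothesis
    on \<open>k\<close> becomes \<open>al = e * ga\<close>.\<close>
  define e where "e = mu * q'"
  have e: "e * e = 1"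
    using True q mu unfolding e_def by algebra
  have mu_e: "mu = e * q" "mu' = e * q'"
    unfolding e_def using True q(1) by algebra+
  have "k * (mu + mu' - mu * q'^2 - mu' * q^2) = 0"
    unfolding mu_e using q(1) by algebra
  then have "(q + q') * al - ga * (mu + mu') = 0"
    using k q by simp
  then have "(q + q') * (al - e * ga) = 0"
    unfolding mu_e by algebra
  then have ale: "al = e * ga"
    using q by simp
  \<comment> \<open>The sign \<open>e\<close> is absorbed into \<open>be\<close> and into
    \<open>c + 1/c = e * Z\<close>.\<close>
  obtain b b' x Z where b: "b * b' = 1" and ga: "ga = (b + b') * (x + Z)"
    and be: "e * be = x * Z + (b + b')^2"
    and k': "k / (q - q') = x * (q' * b' - q * b) - Z * (q * b' - q' * b)"
    using scalars_solvable_special[OF q, of ga "e * be" "k / (q - q')"] by blast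
  obtain a a' c c' where a: "a * a' = 1" "a + a' = x" and c: "c * c' = 1" "c + c' = e * Z"
    using sum_with_inverse_exists by metis
  have w: "b * mu' * q + b' * mu * q' = e * (b + b')"
    unfolding mu_e using q(1) by algebra
  have "k = (q - q') * (k / (q - q'))"
    using q by simp
  also have "\<dots> = (a * b' * mu + a' * b * mu') * (mu + mu' - mu * q^2 - mu' * q'^2) +
      (q - q') * (b' * mu - b * mu') * (q' * mu' * a' - (c + c') + q * a * mu)"
    unfolding k' mu_e c(2) raising_defect_special[OF a(1) b e q(1), symmetric, unfolded a(2)] ..
  finally have k2: "k = \<dots>" .
  have be': "be = e * (x * Z + (b + b')^2)"
    unfolding be[symmetric] using e by algebra
  have eqs: "e * ((b + b') * (x + Z)) = (b + b') * (e * Z) + x * (e * (b + b'))"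
    "e * (x * Z + (b + b')^2) = e * Z * x + (b + b') * (e * (b + b'))"
    by algebra+
  have "(b + b') * (x + Z) = x * (b + b') + e * Z * (e * (b + b'))"
    using e by algebra
  then have "?P a a' b b' c c'"
    using a(1) b c(1) k2 eqs unfolding w a(2) c(2) ale ga be' by blast
  then show ?thesis
    by blast
qed

section \<open>Eigenvectors\<close>

locale alg_closed_fin_dim_space =
  finite_dimensional_vector_space sc Basis
  for sc :: "'a::alg_closed_field \<Rightarrow> 'v::ab_group_add \<Rightarrow> 'v" and Basis
begin

abbreviation lin :: "('v \<Rightarrow> 'v) \<Rightarrow> bool" where
  "lin \<equiv> Vector_Spaces.linear sc sc"

lemma lin_simps:
  assumes "lin T"
  shows "T (x + y) = T x + T y" "T (sc c x) = sc c (T x)" "T 0 = 0" "T (- x) = - T x"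
    "T (x - y) = T x - T y" "T (\<Sum>i\<in>I. g i) = (\<Sum>i\<in>I. T (g i))"
proof -
  interpret T: Vector_Spaces.linear sc sc T by fact
  show "T (x + y) = T x + T y" "T (sc c x) = sc c (T x)" "T 0 = 0" "T (- x) = - T x"
    "T (x - y) = T x - T y" "T (\<Sum>i\<in>I. g i) = (\<Sum>i\<in>I. T (g i))"
    by (fact T.add T.scale T.zero T.neg T.diff T.sum)+
qed

lemma linI:
  assumes "\<And>x y. T (x + y) = T x + T y" "\<And>c x. T (sc c x) = sc c (T x)"
  shows "lin T"
  using assms by unfold_locales

section \<open>Polynomials in an operator\<close>

definition papply :: "('v \<Rightarrow> 'v) \<Rightarrow> 'a poly \<Rightarrow> 'v \<Rightarrow> 'v" where
  "papply T p v = (\<Sum>i\<le>degree p. sc (coeff p i) ((T ^^ i) v))"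

lemma papply_alt:
  assumes "degree p \<le> n"
  shows "papply T p v = (\<Sum>i\<le>n. sc (coeff p i) ((T ^^ i) v))"
  unfolding papply_def using assms
  by (intro sum.mono_neutral_left) (auto simp: coeff_eq_0)

lemma papply_linear_factor:
  assumes T: "lin T"
  shows "papply T ([:- r, 1:] * p) v = T (papply T p v) - sc r (papply T p v)"
proof -
  let ?n = "degree p"
  have d: "degree ([:- r, 1:] * p) \<le> Suc ?n"
    using degree_mult_le[of "[:- r, 1:]" p] by simp
  have "papply T ([:- r, 1:] * p) v
      = (\<Sum>i\<le>Suc ?n. sc (coeff ([:- r, 1:] * p) i) ((T ^^ i) v))"
    by (rule papply_alt[OF d])
  also have "\<dots> = (\<Sum>i\<le>Suc ?n. sc (coeff (pCons 0 p) i) ((T ^^ i) v))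
      - (\<Sum>i\<le>Suc ?n. sc r (sc (coeff p i) ((T ^^ i) v)))"
    by (simp add: scale_left_diff_distrib sum_subtractf)
  also have "(\<Sum>i\<le>Suc ?n. sc (coeff (pCons 0 p) i) ((T ^^ i) v)) = T (papply T p v)"
    unfolding sum.atMost_Suc_shift papply_def by (simp add: lin_simps[OF T])
  also have "(\<Sum>i\<le>Suc ?n. sc r (sc (coeff p i) ((T ^^ i) v))) = sc r (papply T p v)"
    unfolding scale_sum_right[symmetric] by (subst papply_alt[of p "Suc ?n"]) auto
  finally show ?thesis .
qed

lemma papply_mem:
  assumes "subspace E" "\<And>x. x \<in> E \<Longrightarrow> T x \<in> E" "v \<in> E"
  shows "papply T p v \<in> E"
proof -
  have "(T ^^ i) v \<in> E" for i
    by (induction i) (use assms in auto)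
  then show ?thesis
    unfolding papply_def using assms(1) by (intro subspace_sum subspace_scale)
qed

text \<open>One more iterate of \<open>v\<close> than the dimension forces a dependence. Dependence
  is a property of sets, so a repetition among the iterates is treated on its own; it yields a
  difference of two monomials.\<close>

lemma annihilating_poly_exists:
  shows "\<exists>p. p \<noteq> 0 \<and> papply T p v = 0"
proof (cases "inj_on (\<lambda>i. (T ^^ i) v) {..dimension}")
  case False
  then obtain i j where ij: "i \<noteq> j" "(T ^^ i) v = (T ^^ j) v"
    by (auto simp: inj_on_def)
  let ?p = "monom 1 i - monom (1::'a) j"
  have "coeff ?p i \<noteq> 0"
    using ij by simp
  then have "?p \<noteq> 0"
    by (metis coeff_0)
  moreover have "degree ?p \<le> max i j"
    by (rule degree_diff_le) (auto intro: order.trans[OF degree_monom_le])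
  then have "papply T ?p v = (\<Sum>k\<le>max i j. sc (coeff ?p k) ((T ^^ k) v))"
    by (rule papply_alt)
  then have "papply T ?p v = 0"
    using ij by (simp add: scale_left_diff_distrib sum_subtractf if_distrib[of "\<lambda>c. sc c _"] cong: if_cong)
  ultimately show ?thesis by blast
next
  case True
  let ?S = "(\<lambda>i. (T ^^ i) v) ` {..dimension}"
  have "card ?S = Suc dimension"
    using card_image[OF True] by simp
  then have "dependent ?S"
    using independent_card_le_dim[of ?S UNIV] by (auto simp: dim_UNIV dimension_def)
  then obtain u where u: "\<exists>x\<in>?S. u x \<noteq> 0" "(\<Sum>x\<in>?S. sc (u x) x) = 0"
    using dependent_finite[of ?S] by auto
  define p where "p = (\<Sum>i\<le>dimension. monom (u ((T ^^ i) v)) i)"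
  have c: "coeff p i = u ((T ^^ i) v)" if "i \<le> dimension" for i
    using that by (simp add: p_def coeff_sum)
  have "p \<noteq> 0"
    using u(1) c by fastforce
  moreover have "degree p \<le> dimension"
    unfolding p_def by (intro degree_sum_le) (auto intro: order.trans[OF degree_monom_le])
  then have "papply T p v = (\<Sum>i\<le>dimension. sc (u ((T ^^ i) v)) ((T ^^ i) v))"
    by (simp add: papply_alt c)
  then have "papply T p v = 0"
    using u(2) by (simp add: sum.reindex[OF True])
  ultimately show ?thesis by blast
qed

text \<open>Linear factors are split off an annihilating polynomial: the remaining cofactor either
  annihilates \<open>v\<close> itself or sends it to an eigenvector. The invariant subspace
  \<open>E\<close> allows the search to stay inside a weight space.\<close>

lemma eigenvector_exists:
  assumes T: "lin T" and E: "subspace E" "\<And>x. x \<in> E \<Longrightarrow> T x \<in> E" and v: "v \<in> E" "v \<noteq> 0"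
  shows "\<exists>w k. w \<in> E \<and> w \<noteq> 0 \<and> T w = sc k w"
proof -
  have "\<exists>w k. w \<in> E \<and> w \<noteq> 0 \<and> T w = sc k w" if "p \<noteq> 0" "papply T p v = 0" for p
    using that
  proof (induction "degree p" arbitrary: p rule: less_induct)
    case less
    show ?case
    proof (cases "degree p = 0")
      case True
      then obtain c where "p = [:c:]"
        using degree_eq_zeroE by blast
      then show ?thesis
        using less.prems v by (simp add: papply_def)
    next
      case False
      then obtain r where "poly p r = 0"
        using alg_closed_imp_poly_has_root[of p] by auto
      then obtain s where s: "p = [:- r, 1:] * s"
        by (auto simp: poly_eq_0_iff_dvd elim: dvdE)
      have s0: "s \<noteq> 0"
        using less.prems s by auto
      then have "degree s < degree p"
        unfolding s by (subst degree_mult_eq) auto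
      moreover have "T (papply T s v) = sc r (papply T s v)"
        using less.prems(2) papply_linear_factor[OF T, of r s v] s by simp
      ultimately show ?thesis
        using less.hyps[of s] s0 papply_mem[where T = T and p = s, OF E v(1)] by blast
    qed
  qed
  then show ?thesis
    using annihilating_poly_exists by blast
qed

end

section \<open>Irreducible modules\<close>

text \<open>\<open>q4\<close> keeps \<open>q + q'\<close> and \<open>q - q'\<close>, hence all
  denominators, away from 0.\<close>

locale irreducible_aw_module = alg_closed_fin_dim_space sc Basis
  for sc :: "'a::alg_closed_field \<Rightarrow> 'v::ab_group_add \<Rightarrow> 'v" and Basis +
  fixes q :: 'a and A B C :: "'v \<Rightarrow> 'v"
  assumes q0: "q \<noteq> 0" and q4: "q ^ 4 \<noteq> 1"
    and aw: "aw_module sc q A B C" and irr: "aw_irreducible sc A B C"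
begin

abbreviation "q' \<equiv> inverse q"

lemma qq': "q * q' = 1"
  using q0 by simp

lemma q_plus_minus: "q + q' \<noteq> 0" "q - q' \<noteq> 0"
proof -
  have "(q + q') * (q - q') * q^2 = q^4 - 1"
    using qq' by algebra
  then show "q + q' \<noteq> 0" "q - q' \<noteq> 0"
    using q4 by auto
qed

lemma linA: "lin A" and linB: "lin B" and linC: "lin C"
  using aw by (auto simp: aw_module_def)

lemmas ABC_simps = lin_simps[OF linA] lin_simps[OF linB] lin_simps[OF linC]

lemma submodule_UNIV:
  assumes "subspace W" "\<And>x. x \<in> W \<Longrightarrow> A x \<in> W" "\<And>x. x \<in> W \<Longrightarrow> B x \<in> W" "\<And>x. x \<in> W \<Longrightarrow> C x \<in> W"
    and "v \<in> W" "v \<noteq> 0"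
  shows "W = UNIV"
  using irr assms unfolding aw_irreducible_def by blast

text \<open>An eigenspace of \<open>T\<close> is a nonzero submodule.\<close>

lemma schur:
  assumes T: "lin T" and comm: "\<And>v. T (A v) = A (T v)" "\<And>v. T (B v) = B (T v)" "\<And>v. T (C v) = C (T v)"
  shows "\<exists>k. \<forall>v. T v = sc k v"
proof -
  obtain x :: 'v where "x \<noteq> 0"
    using irr unfolding aw_irreducible_def by blast
  then obtain w k where w: "w \<noteq> 0" "T w = sc k w"
    using eigenvector_exists[OF T, of UNIV x] by auto
  have "{v. T v = sc k v} = UNIV"
    by (rule submodule_UNIV[OF _ _ _ _ _ w(1)])
      (auto simp: subspace_def lin_simps[OF T] ABC_simps comm w scale_right_distrib mult.commute)
  then show ?thesis by blast
qed

lemma lin_central: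
  assumes "lin X" "lin Y" "lin Z"
  shows "lin (aw_central_A sc q X Y Z)"
  by (rule linI) (simp_all add: aw_central_A_def lin_simps[OF assms(1)] lin_simps[OF assms(2)]
      lin_simps[OF assms(3)] scale_right_distrib scale_right_diff_distrib mult.commute mult.left_commute)

lemma central_scalar:
  assumes Z: "Z \<in> {aw_central_A sc q A B C, aw_central_A sc q B C A, aw_central_A sc q C A B}"
  shows "\<exists>k. \<forall>v. Z v = sc (k * inverse (q + q')) v"
proof -
  have "lin Z"
    using Z linA linB linC by (auto intro: lin_central)
  moreover have "Z \<circ> X = X \<circ> Z" if "X \<in> {A, B, C}" for X
    using aw Z that unfolding aw_module_def by blast
  then have "Z (A v) = A (Z v)" "Z (B v) = B (Z v)" "Z (C v) = C (Z v)" for v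
    by (simp_all add: fun_eq_iff)
  ultimately obtain k where k: "\<forall>v. Z v = sc k v"
    using schur by blast
  have "k = k * (q + q') * inverse (q + q')"
    using q_plus_minus by simp
  then show ?thesis
    using k by metis
qed

text \<open>The central elements of the algebra are \<open>q + q'\<close> times the expressions
  \<open>aw_central_A\<close>, hence the division.\<close>

definition "alpha = (SOME k. \<forall>v. aw_central_A sc q A B C v = sc (k * inverse (q + q')) v)"
definition "beta = (SOME k. \<forall>v. aw_central_A sc q B C A v = sc (k * inverse (q + q')) v)"
definition "gamma = (SOME k. \<forall>v. aw_central_A sc q C A B v = sc (k * inverse (q + q')) v)"

lemma alpha: "aw_central_A sc q A B C v = sc (alpha * inverse (q + q')) v"
  and beta: "aw_central_A sc q B C A v = sc (beta * inverse (q + q')) v"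
  and gamma: "aw_central_A sc q C A B v = sc (gamma * inverse (q + q')) v"
  unfolding alpha_def beta_def gamma_def
  by (rule someI_ex[OF central_scalar, THEN spec], simp)+

section \<open>Elimination of C\<close>

lemma C_eq: "C v = sc (gamma * inverse (q + q')) v
    - sc (inverse (q^2 - q'^2)) (sc q (A (B v)) - sc q' (B (A v)))"
  using gamma[of v] unfolding aw_central_A_def by (rule eq_diff_eq[THEN iffD2])

lemma square_diff_factor: "(q^2 - q'^2) = (q - q') * (q + q')"
  by algebra

lemma inverse_coeffs:
  defines "Ki \<equiv> inverse (q^2 - q'^2)" and "Qi \<equiv> inverse (q + q')"
  shows "(q^2 - q'^2) * Ki = 1" "(q + q') * Qi = 1"
proof -
  have "q^2 - q'^2 \<noteq> 0"
    unfolding square_diff_factor using q_plus_minus by simp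
  then show "(q^2 - q'^2) * Ki = 1" "(q + q') * Qi = 1"
    using q_plus_minus unfolding Ki_def Qi_def by (simp_all only: right_inverse not_False_eq_True)
qed

text \<open>The coefficients that appear when denominators are cleared by
  \<open>(q^2 - q'^2)^2\<close>, with \<open>g\<close> one of the central scalars.\<close>

lemma coeff_products:
  defines "Ki \<equiv> inverse (q^2 - q'^2)" and "Qi \<equiv> inverse (q + q')"
  shows "(q^2 - q'^2)^2 * Ki^2 * x = x"
    and "(q^2 - q'^2)^2 * Ki * (q - q') * g * Qi = (q - q')^2 * g"
    and "(q^2 - q'^2)^2 * g * Qi = (q - q')^2 * ((q + q') * g)"
proof -
  define k p m where "k = q^2 - q'^2" and "p = q + q'" and "m = q - q'"
  have k: "k * Ki = 1" and p: "p * Qi = 1" and kmp: "k = m * p"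
    unfolding k_def p_def m_def Ki_def Qi_def by (fact inverse_coeffs square_diff_factor)+
  have "k^2 * Ki^2 * x = (k * Ki)^2 * x"
    by (simp add: power_mult_distrib)
  then show "(q^2 - q'^2)^2 * Ki^2 * x = x"
    using k by (simp add: k_def)
  have "k^2 * Ki * m * g * Qi = (k * Ki) * (k * Qi) * m * g"
    by (simp add: power2_eq_square mult_ac)
  also have "k * Qi = m * (p * Qi)"
    by (simp add: kmp)
  finally show "(q^2 - q'^2)^2 * Ki * (q - q') * g * Qi = (q - q')^2 * g"
    unfolding k p by (simp add: k_def m_def power2_eq_square)
  have "k^2 * g * Qi = m^2 * (p * Qi) * (p * g)"
    by (simp add: kmp power2_eq_square mult_ac)
  then show "(q^2 - q'^2)^2 * g * Qi = (q - q')^2 * ((q + q') * g)"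
    unfolding p by (simp add: k_def p_def m_def)
qed

text \<open>An Askey--Wilson relation: \<open>C_eq\<close> is inserted into the equation for
  \<open>alpha\<close>. In the same way \<open>beta\<close> gives
  \<open>relation_BA\<close>.\<close>

lemma relation_AB: "B (B (A v)) - sc (q^2 + q'^2) (B (A (B v))) + A (B (B v)) + sc ((q^2 - q'^2)^2) (A v)
    = sc ((q - q')^2 * ((q + q') * alpha)) v - sc ((q - q')^2 * gamma) (B v)"
proof -
  define Ki Qi K where "Ki = inverse (q^2 - q'^2)" and "Qi = inverse (q + q')" and "K = q^2 - q'^2"
  have "sc (alpha * Qi) v = A v + sc Ki (sc q (sc (gamma * Qi) (B v)
      - sc Ki (sc q (B (A (B v))) - sc q' (B (B (A v)))))
      - sc q' (sc (gamma * Qi) (B v) - sc Ki (sc q (A (B (B v))) - sc q' (B (A (B v))))))"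
    using alpha[of v] unfolding aw_central_A_def C_eq[of v] C_eq[of "B v"] ABC_simps Ki_def Qi_def by (rule sym)
  then have "sc (K^2 * alpha * Qi) v = sc (K^2) (A v + sc Ki (sc q (sc (gamma * Qi) (B v)
      - sc Ki (sc q (B (A (B v))) - sc q' (B (B (A v)))))
      - sc q' (sc (gamma * Qi) (B v) - sc Ki (sc q (A (B (B v))) - sc q' (B (A (B v)))))))"
    by (metis scale_scale mult.assoc)
  also have "\<dots> = sc (K^2) (A v) + sc (K^2 * Ki * (q - q') * gamma * Qi) (B v)
      + sc (K^2 * Ki^2 * (q * q')) (B (B (A v))) + sc (K^2 * Ki^2 * (q * q')) (A (B (B v)))
      - sc (K^2 * Ki^2 * (q^2 + q'^2)) (B (A (B v)))"
    by (simp add: algebra_simps power2_eq_square scale_left_distrib scale_right_distrib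
        scale_right_diff_distrib scale_left_diff_distrib)
  finally show ?thesis
    unfolding Ki_def Qi_def K_def coeff_products qq' by (simp add: algebra_simps)
qed

lemma relation_BA: "A (A (B v)) - sc (q^2 + q'^2) (A (B (A v))) + B (A (A v)) + sc ((q^2 - q'^2)^2) (B v)
    = sc ((q - q')^2 * ((q + q') * beta)) v - sc ((q - q')^2 * gamma) (A v)"
proof -
  define Ki Qi K where "Ki = inverse (q^2 - q'^2)" and "Qi = inverse (q + q')" and "K = q^2 - q'^2"
  have "sc (beta * Qi) v = B v + sc Ki (sc q (sc (gamma * Qi) (A v)
      - sc Ki (sc q (A (B (A v))) - sc q' (B (A (A v)))))
      - sc q' (sc (gamma * Qi) (A v) - sc Ki (sc q (A (A (B v))) - sc q' (A (B (A v))))))"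
    using beta[of v] unfolding aw_central_A_def C_eq[of v] C_eq[of "A v"] ABC_simps Ki_def Qi_def by (rule sym)
  then have "sc (K^2 * beta * Qi) v = sc (K^2) (B v + sc Ki (sc q (sc (gamma * Qi) (A v)
      - sc Ki (sc q (A (B (A v))) - sc q' (B (A (A v)))))
      - sc q' (sc (gamma * Qi) (A v) - sc Ki (sc q (A (A (B v))) - sc q' (A (B (A v)))))))"
    by (metis scale_scale mult.assoc)
  also have "\<dots> = sc (K^2) (B v) + sc (K^2 * Ki * (q - q') * gamma * Qi) (A v)
      + sc (K^2 * Ki^2 * (q * q')) (B (A (A v))) + sc (K^2 * Ki^2 * (q * q')) (A (A (B v)))
      - sc (K^2 * Ki^2 * (q^2 + q'^2)) (A (B (A v)))"
    by (simp add: algebra_simps power2_eq_square scale_left_distrib scale_right_distrib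
        scale_right_diff_distrib scale_left_diff_distrib)
  finally show ?thesis
    unfolding Ki_def Qi_def K_def coeff_products qq' by (simp add: algebra_simps)
qed

lemma marginal_vector_exists:
  assumes "aw_marginal_weight sc q A B mu"
  shows "\<exists>v k. v \<noteq> 0 \<and> B v = sc (mu + inverse mu) v \<and>
    B (A v) = sc (mu * q^2 + inverse mu * q'^2) (A v) + sc k v \<and>
    k * (mu + inverse mu - mu * q'^2 - inverse mu * q^2)
      = (q - q')^2 * ((q + q') * alpha - gamma * (mu + inverse mu))"
proof -
  define mu' where "mu' = inverse mu"
  have mu: "mu * mu' = 1"
    using assms by (simp add: aw_marginal_weight_def mu'_def)
  define th where "th = mu + mu'"
  define th1 where "th1 = mu * q^2 + mu' * q'^2"
  define th2 where "th2 = mu * q'^2 + mu' * q^2"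
  define r where "r = (q - q')^2 * ((q + q') * alpha - gamma * th)"
  \<comment> \<open>With these two values the relation on a vector of weight \<open>mu\<close>
    factors as \<open>(B - th1) (B - th2) A v = r v\<close>.\<close>
  have b1: "(q^2 + q'^2) * th = th1 + th2"
    unfolding th1_def th2_def th_def by algebra
  have b2: "th^2 + (q^2 - q'^2)^2 = th1 * th2"
    unfolding th1_def th2_def th_def using mu qq' by algebra
  have R: "B (B (A v)) - sc (th1 + th2) (B (A v)) + sc (th1 * th2) (A v) = sc r v"
    if "B v = sc th v" for v
  proof -
    have "B (B (A v)) - sc ((q^2 + q'^2) * th) (B (A v)) + sc (th^2 + (q^2 - q'^2)^2) (A v) = sc r v"
      using relation_AB[of v] unfolding that ABC_simps r_def
      by (simp add: scale_left_distrib[of "th * th"] scale_left_diff_distrib right_diff_distrib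
          power2_eq_square[of th] mult.assoc add.assoc)
    then show ?thesis
      unfolding b1 b2 .
  qed
  obtain v where v: "v \<noteq> 0" "B v = sc th v"
    and m: "B (B (A v) - sc th (A v)) - sc th1 (B (A v) - sc th (A v)) = 0"
    using assms unfolding aw_marginal_weight_def Let_def th_def th1_def mu'_def by blast
  have m': "B (B (A v)) - sc (th1 + th) (B (A v)) + sc (th1 * th) (A v) = 0"
    using m by (simp add: ABC_simps algebra_simps scale_left_distrib scale_right_diff_distrib)
  \<comment> \<open>Marginality is \<open>(B - th1) (B - th) A v = 0\<close>; subtracting it cancels
    the terms quadratic in \<open>B\<close>.\<close>
  have key: "sc (th - th2) (B (A v) - sc th1 (A v)) = sc r v"
  proof -
    have "sc r v = (B (B (A v)) - sc (th1 + th2) (B (A v)) + sc (th1 * th2) (A v))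
      - (B (B (A v)) - sc (th1 + th) (B (A v)) + sc (th1 * th) (A v))"
      unfolding m' R[OF v(2)] by simp
    also have "\<dots> = sc (th - th2) (B (A v) - sc th1 (A v))"
      by (simp add: algebra_simps scale_left_distrib scale_right_diff_distrib scale_left_diff_distrib)
    finally show ?thesis ..
  qed
  have "\<exists>v k. v \<noteq> 0 \<and> B v = sc th v \<and> B (A v) = sc th1 (A v) + sc k v \<and> k * (th - th2) = r"
  proof (cases "th = th2")
    case False
    define k where "k = r / (th - th2)"
    have "B (A v) - sc th1 (A v) = sc (inverse (th - th2)) (sc (th - th2) (B (A v) - sc th1 (A v)))"
      using False by simp
    also have "\<dots> = sc k v"
      unfolding key k_def by (simp add: field_simps)
    finally have "B (A v) = sc th1 (A v) + sc k v"
      by (simp add: algebra_simps)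
    then show ?thesis
      using v False by (intro exI[of _ v] exI[of _ k]) (simp add: k_def)
  next
    case True
    then have r0: "r = 0"
      using key v(1) by simp
    \<comment> \<open>As \<open>r = 0\<close>, the relation says that \<open>T\<close>, that is
      \<open>(B - th1) A\<close>, maps the weight space of \<open>mu\<close> into itself; an
      eigenvector there replaces \<open>v\<close>.\<close>
    define T where "T = (\<lambda>x. B (A x) - sc th1 (A x))"
    have "lin T"
      by (rule linI) (simp_all add: T_def ABC_simps algebra_simps scale_right_distrib scale_right_diff_distrib)
    moreover have "B (T x) = sc th (T x)" if "B x = sc th x" for x
      using R[OF that] unfolding T_def r0 True[symmetric]
      by (simp add: ABC_simps algebra_simps scale_left_distrib scale_right_diff_distrib)
    moreover have "subspace {x. B x = sc th x}"
      by (auto simp: subspace_def ABC_simps scale_right_distrib mult.commute)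
    ultimately obtain w k where "w \<noteq> 0" "B w = sc th w" "T w = sc k w"
      using eigenvector_exists[of T "{x. B x = sc th x}" v] v by auto
    then show ?thesis
      using True r0 by (intro exI[of _ w] exI[of _ k]) (simp add: T_def algebra_simps)
  qed
  then show ?thesis
    unfolding th_def th1_def th2_def mu'_def r_def by (simp add: diff_diff_eq)
qed

end

section \<open>The vectors of the Verma basis\<close>

lemma verma_space_iff: "x \<in> verma_space \<longleftrightarrow> (\<exists>N. \<forall>i\<ge>N. x i = 0)"
proof -
  have "finite {i. x i \<noteq> 0} \<longleftrightarrow> (\<exists>N. \<forall>i\<in>{i. x i \<noteq> 0}. i < N)"
    by (rule finite_nat_set_iff_bounded)
  also have "\<dots> \<longleftrightarrow> (\<exists>N. \<forall>i\<ge>N. x i = 0)"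
    by (metis (mono_tags, lifting) mem_Collect_eq not_le)
  finally show ?thesis
    by (simp add: verma_space_def)
qed

text \<open>Powers and inverses become separate variables, so that this and the next two are
  polynomial identities. \<open>X\<close> stands for \<open>q^(2*n)\<close> here and in
  \<open>theta_quadratic_aux\<close>, for \<open>q^n\<close> in
  \<open>phi_factor_aux\<close>.\<close>

lemma theta_recurrence_aux:
  fixes q q' :: "'a::field"
  assumes "q * q' = 1"
  shows "x * y * X + x' * y' * X' + (x * y * (X * q^4) + x' * y' * (X' * q'^4))
    = (q^2 + q'^2) * (x * y * (X * q^2) + x' * y' * (X' * q'^2))"
  using assms by algebra

lemma theta_quadratic_aux:
  fixes q q' :: "'a::field"
  assumes "q * q' = 1" "X * X' = 1" "a * a' = 1" "l * l' = 1"
  shows "(a * l' * X + a' * l * X')^2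
    - (q^2 + q'^2) * (a * l' * X + a' * l * X') * (a * l' * (X * q^2) + a' * l * (X' * q'^2))
    + (a * l' * (X * q^2) + a' * l * (X' * q'^2))^2 + (q^2 - q'^2)^2 = 0"
  using assms by algebra

text \<open>Multiplying out the last two factors shows that \<open>c\<close> enters only through
  \<open>c + c'\<close>, as it does in the scalars.\<close>

lemma phi_factor_aux:
  fixes q q' :: "'a::field"
  assumes "q * q' = 1" "X * X' = 1" "a * a' = 1" "b * b' = 1" "c * c' = 1" "l * l' = 1"
  shows "a' * b' * l * q * (X - X') * (l' * (X * q') - l * (q * X')) *
      (X' - a * b * c * l' * (X * q')) * (X' - a * b * c' * l' * (X * q'))
    = (X - X') * (l' * q' * X - l * q * X') * (a' * b' * l * q * X'^2 + a * b * l' * q' * X^2 - (c + c'))"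
  using assms by algebra

text \<open>The situation once the parameters are chosen. \<open>Bv\<close> and \<open>BAv\<close>
  are the Verma relations for \<open>m_0 = v\<close> and \<open>m_1 = (A - theta_0) v\<close>, the
  latter expanded in \<open>A v\<close> and \<open>v\<close>.\<close>

locale verma_vector = irreducible_aw_module sc Basis q A B C
  for sc :: "'a::alg_closed_field \<Rightarrow> 'v::ab_group_add \<Rightarrow> 'v" and Basis q A B C +
  fixes v :: 'v and a b c lam :: 'a
  assumes nz: "a \<noteq> 0" "b \<noteq> 0" "c \<noteq> 0" "lam \<noteq> 0" and v0: "v \<noteq> 0"
    and beta_eq: "beta = (c + inverse c) * (a + inverse a) + (b + inverse b) * (lam * q + inverse lam * inverse q)"
    and gamma_eq: "gamma = (a + inverse a) * (b + inverse b) + (c + inverse c) * (lam * q + inverse lam * inverse q)"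
    and Bv: "B v = sc (aw_theta q b lam 0) v"
    and BAv: "B (A v) = sc (aw_theta q b lam 1) (A v) +
      sc (aw_theta q a lam 0 * (aw_theta q b lam 0 - aw_theta q b lam 1) + aw_phi q a b c lam 1) v"
begin

abbreviation "th \<equiv> aw_theta q a lam"
abbreviation "ts \<equiv> aw_theta q b lam"
abbreviation "ph \<equiv> aw_phi q a b c lam"

lemma theta_recurrence: "aw_theta q x lam n + aw_theta q x lam (n + 2) = (q^2 + q'^2) * aw_theta q x lam (n + 1)"
proof -
  have "q^(2 * (n + 2)) = q^(2*n) * q^4" "q'^(2 * (n + 2)) = q'^(2*n) * q'^4"
    "q^(2 * (n + 1)) = q^(2*n) * q^2" "q'^(2 * (n + 1)) = q'^(2*n) * q'^2"
    unfolding distrib_left power_add by simp_all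
  then show ?thesis
    unfolding aw_theta_def using theta_recurrence_aux[OF qq'] by (simp only:)
qed

text \<open>For the indices \<open>n - 1\<close> and \<open>n\<close> this is the vanishing of the
  coefficient of \<open>m_(n-1)\<close> in \<open>relation_BA\<close> on \<open>m_n\<close>.\<close>

lemma theta_quadratic: "th n ^ 2 - (q^2 + q'^2) * th n * th (n + 1) + th (n + 1) ^ 2 + (q^2 - q'^2)^2 = 0"
proof -
  have *: "q^(2 * (n + 1)) = q^(2*n) * q^2" "q'^(2 * (n + 1)) = q'^(2*n) * q'^2"
    unfolding distrib_left power_add by simp_all
  have "q^(2*n) * q'^(2*n) = 1" "a * inverse a = 1" "lam * inverse lam = 1"
    using nz qq' by (simp_all add: power_mult_distrib[symmetric])
  then show ?thesis
    unfolding aw_theta_def * using theta_quadratic_aux[OF qq'] by blast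
qed

lemma theta_eq: "aw_theta q x lam n = x * inverse lam * (q^n)^2 + inverse x * lam * (q'^n)^2"
  by (simp add: aw_theta_def power_mult[symmetric] mult.commute)

lemma phi_eq: "ph n = (q^n - q'^n) * (inverse lam * q' * q^n - lam * q * q'^n) *
    (inverse a * inverse b * lam * q * (q'^n)^2 + a * b * inverse lam * q' * (q^n)^2 - (c + inverse c))"
proof -
  have p: "q powi (int n - 1) = q^n * q'" "q powi (1 - int n) = q * q'^n"
    using q0 by (simp_all add: power_int_diff power_int_minus field_simps)
  have "q^n * q'^n = 1" "a * inverse a = 1" "b * inverse b = 1" "c * inverse c = 1" "lam * inverse lam = 1"
    using nz qq' by (simp_all add: power_mult_distrib[symmetric])
  then show ?thesis
    unfolding aw_phi_def p using phi_factor_aux[OF qq'] by blast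
qed

lemma phi_0: "ph 0 = 0"
  by (simp add: aw_phi_def)

text \<open>These come from the coefficients of \<open>m_(n+1)\<close> and \<open>m_n\<close> in
  \<open>relation_BA\<close> on \<open>m_n\<close>. In the second, \<open>th (n - 1)\<close> is
  written as \<open>(q^2 + q'^2) * th n - th (n + 1)\<close>, which also makes sense for
  \<open>n = 0\<close>.\<close>

lemma phi_theta_identities:
  shows "ts n * (th n + th (n + 1)) + ph n
      - (q^2 + q'^2) * (ts (n + 1) * th (n + 1) + ph (n + 1) + th n * ts n)
      + ph (n + 2) + ts (n + 1) * (th n + th (n + 1)) = - ((q - q')^2 * gamma)" (is ?A)
    and "2 * ts n * th n ^ 2 - (q^2 + q'^2) * th n ^ 2 * ts n + (q^2 - q'^2)^2 * ts n
      + ph n * (th n - th (n + 1)) + ph (n + 1) * (th n + th (n + 1) - (q^2 + q'^2) * th n)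
     = (q - q')^2 * ((q + q') * beta - gamma * th n)" (is ?B)
proof -
  define u u' s s' b' X X' where "u = a * inverse lam" and "u' = inverse a * lam"
    and "s = b * inverse lam" and "s' = inverse b * lam" and "b' = inverse b"
    and "X = q^n" and "X' = q'^n"
  have inv2: "x * inverse y * (inverse x * y) = 1" if "x \<noteq> 0" "y \<noteq> 0" for x y :: 'a
    using that by (simp add: field_simps)
  have hyps: "u * u' = 1" "s * s' = 1" "b * b' = 1" "X * X' = 1"
    using nz q0 inv2[of a lam] inv2[of b lam]
    by (simp_all add: u_def u'_def s_def s'_def b'_def X_def X'_def power_mult_distrib[symmetric])
  have [simp]: "s * b' = inverse lam" "s' * b = lam" "u' * b' = inverse a * inverse b * lam"
    "u * s' * b = a" "u' * s * b' = inverse a" "u * b = a * b * inverse lam"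
    using nz by (simp_all add: u_def u'_def s_def s'_def b'_def field_simps)
  have pw: "q^(n+1) = q * X" "q'^(n+1) = q' * X'" "q^(n+2) = q^2 * X" "q'^(n+2) = q'^2 * X'"
    by (simp_all add: X_def X'_def power2_eq_square)
  have t: "th n = u * X^2 + u' * X'^2" "ts n = s * X^2 + s' * X'^2"
    "th (n + 1) = u * (q * X)^2 + u' * (q' * X')^2" "ts (n + 1) = s * (q * X)^2 + s' * (q' * X')^2"
    unfolding theta_eq pw by (simp_all only: u_def u'_def s_def s'_def X_def X'_def)
  define P where "P = (\<lambda>X X'. (X - X') * (s * b' * q' * X - s' * b * q * X') * (u' * b' * q * X'^2 + u * b * q' * X^2 - (c + inverse c)))"
  have p: "ph n = P X X'" "ph (n + 1) = P (q * X) (q' * X')" "ph (n + 2) = P (q^2 * X) (q'^2 * X')"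
    unfolding phi_eq pw P_def by (simp_all add: X_def X'_def)
  have g: "gamma = (u * s' * b + u' * s * b') * (b + b') + (c + inverse c) * (s' * b * q + s * b' * q')"
    "beta = (c + inverse c) * (u * s' * b + u' * s * b') + (b + b') * (s' * b * q + s * b' * q')"
    unfolding gamma_eq beta_eq by (simp_all, simp_all add: b'_def)
  show ?A
    unfolding t p g P_def by (rule phi_recurrence_identity[OF hyps(1-3) qq' hyps(4)])
  have e: "u * X^2 + u' * X'^2 + (u * (q * X)^2 + u' * (q' * X')^2) - (q^2 + q'^2) * (u * X^2 + u' * X'^2)
     = u * X^2 + u' * X'^2 - (u * (q' * X)^2 + u' * (q * X')^2)"
    by (simp add: algebra_simps power_mult_distrib)
  show ?B
    unfolding t p g P_def e by (rule phi_theta_identity[OF hyps(1-3) qq' hyps(4)])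
qed

text \<open>An operator on all of V, since over a full period it is to commute with the module
  action.\<close>

fun raise :: "nat \<Rightarrow> 'v \<Rightarrow> 'v" where
  "raise 0 x = x"
| "raise (Suc n) x = A (raise n x) - sc (th n) (raise n x)"

lemma lin_raise: "lin (raise n)"
  by (induction n) (auto intro!: linI simp: ABC_simps lin_simps scale_right_distrib scale_right_diff_distrib mult.commute)

definition "m n = raise n v"

lemma A_m: "A (m n) = m (Suc n) + sc (th n) (m n)"
  by (simp add: m_def)

text \<open>\<open>x\<close>, \<open>x1\<close>, \<open>x2\<close> are consecutive basis vectors and \<open>w\<close> is the \<open>phi_n\<close>-multiple of the
  vector before \<open>x\<close>, so that \<open>w = 0\<close> for \<open>n = 0\<close>.\<close>

lemma lowering_step:
  assumes x: "A x = x1 + sc (th n) x" "A x1 = x2 + sc (th (n + 1)) x1"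
    and B: "B x = sc (ts n) x + w" "B x1 = sc (ts (n + 1)) x1 + sc (ph (n + 1)) x"
    and w: "A w = sc (ph n) x + sc t w" "ph n * t = ph n * ((q^2 + q'^2) * th n - th (n + 1))"
      "sc (th n ^ 2 - (q^2 + q'^2) * t * th n + t^2 + (q^2 - q'^2)^2) w = 0"
  shows "B x2 = sc (ts (n + 2)) x2 + sc (ph (n + 2)) x1"
proof -
  define be K h where "be = q^2 + q'^2" and "K = (q^2 - q'^2)^2" and "h = (q - q')^2"
  define T T1 S S1 where "T = th n" and "T1 = th (n + 1)" and "S = ts n" and "S1 = ts (n + 1)"
  define P P1 P2 where "P = ph n" and "P1 = ph (n + 1)" and "P2 = ph (n + 2)"
  note d = T_def[symmetric] T1_def[symmetric] S_def[symmetric] S1_def[symmetric]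
    P_def[symmetric] P1_def[symmetric] P2_def[symmetric] be_def[symmetric] K_def[symmetric] h_def[symmetric]
  note xs = x[unfolded d] B[unfolded d] w(1)[unfolded d]
  \<comment> \<open>The three words of \<open>relation_BA\<close> are expanded in \<open>x\<close>,
    \<open>x1\<close>, \<open>x2\<close>, \<open>w\<close>; the only unknown is \<open>B x2\<close>
    inside \<open>B (A (A x))\<close>, so the relation determines it.\<close>
  have AAB: "A (A (B x)) = sc S x2 + sc (S * (T + T1) + P) x1 + sc (S * T^2 + P * T + P * t) x + sc (t^2) w"
    unfolding xs ABC_simps by (simp add: xs ABC_simps algebra_simps power2_eq_square scale_left_distrib scale_right_distrib)
  have ABA: "A (B (A x)) = sc S1 x2 + sc (S1 * T1 + P1 + T * S) x1 + sc (P1 * T + T^2 * S + T * P) x + sc (t * T) w"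
    unfolding xs ABC_simps by (simp add: xs ABC_simps algebra_simps power2_eq_square scale_left_distrib scale_right_distrib)
  have BAA: "B (A (A x)) = B x2 + sc ((T + T1) * S1) x1 + sc ((T + T1) * P1 + T^2 * S) x + sc (T^2) w"
    unfolding xs ABC_simps by (simp add: xs ABC_simps algebra_simps power2_eq_square scale_left_distrib scale_right_distrib)
  have two: "sc (y * (2 * z)) x = sc (y * z) x + sc (y * z) x" for y z
    by (simp only: mult_2 distrib_left scale_left_distrib)
  have "B x2 = sc (h * ((q + q') * beta)) x - sc (h * gamma) (x1 + sc T x) - sc K (sc S x + w)
      - (sc ((T + T1) * S1) x1 + sc ((T + T1) * P1 + T^2 * S) x + sc (T^2) w)
      - (sc S x2 + sc (S * (T + T1) + P) x1 + sc (S * T^2 + P * T + P * t) x + sc (t^2) w)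
      + sc be (sc S1 x2 + sc (S1 * T1 + P1 + T * S) x1 + sc (P1 * T + T^2 * S + T * P) x + sc (t * T) w)"
    using relation_BA[of x, unfolded d, unfolded AAB ABA BAA, unfolded xs] by (simp add: algebra_simps)
  also have "\<dots> = sc (be * S1 - S) x2
      + sc (- (h * gamma) - (T + T1) * S1 - (S * (T + T1) + P) + be * (S1 * T1 + P1 + T * S)) x1
      + sc (h * ((q + q') * beta) - h * gamma * T - K * S - ((T + T1) * P1 + T^2 * S)
         - (S * T^2 + P * T + P * t) + be * (P1 * T + T^2 * S + T * P)) x
      - sc (T^2 - be * t * T + t^2 + K) w"
    by (simp add: two algebra_simps scale_left_distrib scale_right_distrib scale_left_diff_distrib scale_right_diff_distrib)
  \<comment> \<open>Coefficient by coefficient: \<open>w\<close> drops out by the quadratic relation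
    for theta, \<open>x2\<close> gets the next \<open>ts\<close> by the recurrence,
    \<open>x1\<close> gets the next \<open>ph\<close>, and \<open>x\<close> drops out.\<close>
  also have "sc (T^2 - be * t * T + t^2 + K) w = 0"
    using w(3) unfolding d .
  also have "be * S1 - S = ts (n + 2)"
    using theta_recurrence[of b n] unfolding d by (simp add: algebra_simps)
  also have "- (h * gamma) - (T + T1) * S1 - (S * (T + T1) + P) + be * (S1 * T1 + P1 + T * S) = P2"
    using phi_theta_identities(1)[of n] unfolding d by algebra
  also have "h * ((q + q') * beta) - h * gamma * T - K * S - ((T + T1) * P1 + T^2 * S)
         - (S * T^2 + P * T + P * t) + be * (P1 * T + T^2 * S + T * P) = 0"
    using phi_theta_identities(2)[of n] w(2) unfolding d by algebra
  finally show ?thesis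
    by (simp add: P2_def)
qed

text \<open>A two-step recursion through \<open>lowering_step\<close>, started by \<open>Bv\<close>
  and \<open>BAv\<close>. The truncated index at \<open>n = 0\<close> is harmless because
  \<open>ph 0 = 0\<close>.\<close>

lemma B_m: "B (m n) = sc (ts n) (m n) + sc (ph n) (m (n - 1))"
proof (induction n rule: less_induct)
  case (less n)
  consider "n = 0" | "n = 1" | k where "n = k + 2"
    by (metis One_nat_def Suc_eq_plus1 add_2_eq_Suc' old.nat.exhaust)
  then show ?case
  proof cases
    case 1
    then show ?thesis
      by (simp add: Bv phi_0 m_def)
  next
    case 2
    have "B (m 1) = B (A v) - sc (th 0) (B v)"
      by (simp add: m_def ABC_simps)
    also have "\<dots> = sc (ts 1) (A v - sc (th 0) v) + sc (ph 1) v"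
      unfolding BAv Bv
      by (simp add: algebra_simps scale_left_distrib scale_right_distrib scale_left_diff_distrib scale_right_diff_distrib)
    finally show ?thesis
      using 2 by (simp add: m_def)
  next
    case 3
    define w where "w = sc (ph k) (m (k - 1))"
    \<comment> \<open>For \<open>k = 0\<close> truncation gives \<open>th 0\<close>; then
      \<open>ph 0 = 0\<close> makes \<open>w\<close> zero and the conditions on \<open>t\<close>
      trivial.\<close>
    define t where "t = th (k - 1)"
    have "B (m (k + 2)) = sc (ts (k + 2)) (m (k + 2)) + sc (ph (k + 2)) (m (k + 1))"
    proof (rule lowering_step[where w = w and t = t])
      show "A (m k) = m (k + 1) + sc (th k) (m k)" "A (m (k + 1)) = m (k + 2) + sc (th (k + 1)) (m (k + 1))"
        by (simp_all add: A_m)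
      show "B (m k) = sc (ts k) (m k) + w"
        unfolding w_def using less[of k] 3 by simp
      show "B (m (k + 1)) = sc (ts (k + 1)) (m (k + 1)) + sc (ph (k + 1)) (m k)"
        using less[of "k + 1"] 3 by simp
      show "A w = sc (ph k) (m k) + sc t w"
        by (cases k) (simp_all add: w_def t_def phi_0 ABC_simps A_m scale_right_distrib mult.commute)
      show "ph k * t = ph k * ((q^2 + q'^2) * th k - th (k + 1))"
      proof (cases k)
        case (Suc j)
        then show ?thesis
          using theta_recurrence[of a j] by (simp add: t_def eq_diff_eq)
      qed (simp add: phi_0)
      show "sc (th k ^ 2 - (q^2 + q'^2) * t * th k + t^2 + (q^2 - q'^2)^2) w = 0"
      proof (cases k)
        case (Suc j)
        have "th k ^ 2 - (q^2 + q'^2) * t * th k + t^2 + (q^2 - q'^2)^2 = 0"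
          using theta_quadratic[of j] Suc by (simp add: t_def algebra_simps)
        then show ?thesis
          by (simp only: scale_zero_left)
      qed (simp add: phi_0 w_def)
    qed
    then show ?thesis
      using 3 by simp
  qed
qed

end

section \<open>The isomorphism\<close>

lemma verma_spaceE:
  assumes "x \<in> verma_space"
  obtains N where "\<forall>i\<ge>N. x i = 0"
  using assms by (auto simp: verma_space_iff)

lemma verma_space_common_bound:
  assumes "x \<in> verma_space" "y \<in> verma_space"
  obtains N where "\<forall>i\<ge>N. x i = 0" "\<forall>i\<ge>N. y i = 0"
proof -
  obtain M N where "\<forall>i\<ge>M. x i = 0" "\<forall>i\<ge>N. y i = 0"
    using assms by (meson verma_spaceE)
  then show ?thesis
    by (intro that[of "max M N"]) auto
qed

lemma verma_space_scale: "x \<in> verma_space \<Longrightarrow> (\<lambda>i. t * x i :: 'a::field) \<in> verma_space"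
  unfolding verma_space_iff by auto

lemma verma_space_add:
  assumes "x \<in> verma_space" "y \<in> verma_space"
  shows "(\<lambda>i. x i + y i :: 'a::field) \<in> verma_space"
proof -
  obtain N where "\<forall>i\<ge>N. x i = 0" "\<forall>i\<ge>N. y i = 0"
    by (rule verma_space_common_bound[OF assms])
  then show ?thesis
    by (auto simp: verma_space_iff intro!: exI[of _ N])
qed

lemma verma_space_diff:
  assumes "x \<in> verma_space" "y \<in> verma_space"
  shows "(\<lambda>i. x i - y i :: 'a::field) \<in> verma_space"
  using verma_space_add[OF assms(1) verma_space_scale[OF assms(2), of "- 1"]] by simp

lemma verma_space_A: "x \<in> verma_space \<Longrightarrow> verma_A q a b c lam x \<in> verma_space"
  and verma_space_B: "x \<in> verma_space \<Longrightarrow> verma_B q a b c lam x \<in> verma_space"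
proof -
  assume "x \<in> verma_space"
  then obtain N where N: "\<forall>i\<ge>N. x i = 0"
    by (rule verma_spaceE)
  show "verma_A q a b c lam x \<in> verma_space"
    unfolding verma_space_iff verma_A_def using N by (intro exI[of _ "Suc N"]) auto
  show "verma_B q a b c lam x \<in> verma_space"
    unfolding verma_space_iff verma_B_def using N by (intro exI[of _ N]) auto
qed

lemma verma_O_zero: "(\<lambda>j. 0) \<in> verma_O d \<delta>"
  unfolding verma_O_def by (rule CollectI, rule exI[of _ 0]) simp

lemma verma_O_add:
  assumes "x \<in> verma_O d \<delta>"
  shows "(\<lambda>j. x j + t * ((if j = i then \<delta> else 0) - (if j = d + i then 1 else 0))) \<in> verma_O d \<delta>"
proof -
  define g where "g = (\<lambda>i j. (if j = i then \<delta> else 0) - (if j = d + i then 1 else 0))"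
  obtain N k where x: "x = (\<lambda>j. \<Sum>i<N. k i * g i j)"
    using assms by (auto simp: verma_O_def g_def)
  define M where "M = max N (Suc i)"
  \<comment> \<open>The values of \<open>k\<close> beyond \<open>N\<close> are arbitrary, so they
    are cut off before the range grows to \<open>M\<close>.\<close>
  define k' where "k' = (\<lambda>l. (if l < N then k l else 0) + (if l = i then t else 0))"
  have "x j + t * g i j = (\<Sum>l<M. k' l * g l j)" for j
  proof -
    have "(\<Sum>l<M. k' l * g l j) = (\<Sum>l<M. (if l < N then k l * g l j else 0)) + (\<Sum>l<M. (if l = i then t * g l j else 0))"
      unfolding sum.distrib[symmetric] by (rule sum.cong) (auto simp: k'_def algebra_simps)
    also have "(\<Sum>l<M. (if l = i then t * g l j else 0)) = t * g i j"
      by (simp add: M_def)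
    also have "(\<Sum>l<M. (if l < N then k l * g l j else 0)) = (\<Sum>l<N. k l * g l j)"
      by (intro sum.mono_neutral_cong_right) (auto simp: M_def)
    finally show ?thesis
      by (simp add: x)
  qed
  then show ?thesis
    unfolding verma_O_def g_def by blast
qed

section \<open>The homomorphism from the Verma module to V\<close>

context verma_vector
begin

definition eval_m :: "(nat \<Rightarrow> 'a) \<Rightarrow> 'v" where
  "eval_m x = (\<Sum>i | x i \<noteq> 0. sc (x i) (m i))"

lemma eval_m_bound:
  assumes "\<forall>i\<ge>N. x i = 0"
  shows "eval_m x = (\<Sum>i<N. sc (x i) (m i))"
  unfolding eval_m_def using assms
  by (intro sum.mono_neutral_left) (auto, meson not_le)

lemma eval_m_add:
  assumes "x \<in> verma_space" "y \<in> verma_space"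
  shows "eval_m (\<lambda>i. x i + y i) = eval_m x + eval_m y"
proof -
  obtain N where "\<forall>i\<ge>N. x i = 0" "\<forall>i\<ge>N. y i = 0"
    by (rule verma_space_common_bound[OF assms])
  then show ?thesis
    by (simp add: eval_m_bound[of N] scale_left_distrib sum.distrib)
qed

lemma eval_m_scale:
  assumes "x \<in> verma_space"
  shows "eval_m (\<lambda>i. t * x i) = sc t (eval_m x)"
proof -
  obtain N where "\<forall>i\<ge>N. x i = 0"
    using assms by (rule verma_spaceE)
  then show ?thesis
    by (simp add: eval_m_bound[of N] scale_sum_right)
qed

lemma eval_m_diff:
  assumes "x \<in> verma_space" "y \<in> verma_space"
  shows "eval_m (\<lambda>i. x i - y i) = eval_m x - eval_m y"
proof -
  obtain N where "\<forall>i\<ge>N. x i = 0" "\<forall>i\<ge>N. y i = 0"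
    by (rule verma_space_common_bound[OF assms])
  then show ?thesis
    by (simp add: eval_m_bound[of N] scale_left_diff_distrib sum_subtractf)
qed

lemma eval_m_unit: "eval_m (\<lambda>j. if j = i then t else 0) = sc t (m i)"
proof -
  have "eval_m (\<lambda>j. if j = i then t else 0) = (\<Sum>j<Suc i. sc (if j = i then t else 0) (m j))"
    by (rule eval_m_bound) auto
  then show ?thesis
    by simp
qed

lemma unit_mem: "(\<lambda>j. if j = i then t else (0::'a)) \<in> verma_space"
  unfolding verma_space_iff by (rule exI[of _ "Suc i"]) auto

lemma eval_m_A:
  assumes "x \<in> verma_space"
  shows "eval_m (verma_A q a b c lam x) = A (eval_m x)"
proof -
  obtain N where N: "\<forall>i\<ge>N. x i = 0"
    using assms by (rule verma_spaceE)
  have "eval_m (verma_A q a b c lam x)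
      = (\<Sum>i<Suc N. sc (th i * x i + (if i = 0 then 0 else x (i - 1))) (m i))"
    unfolding verma_A_def using N by (intro eval_m_bound) auto
  also have "\<dots> = (\<Sum>i<Suc N. sc (th i * x i) (m i)) + (\<Sum>i<Suc N. sc (if i = 0 then 0 else x (i - 1)) (m i))"
    by (simp only: scale_left_distrib sum.distrib)
  also have "(\<Sum>i<Suc N. sc (if i = 0 then 0 else x (i - 1)) (m i)) = (\<Sum>i<N. sc (x i) (m (Suc i)))"
    unfolding sum.lessThan_Suc_shift by simp
  also have "(\<Sum>i<Suc N. sc (th i * x i) (m i)) = (\<Sum>i<N. sc (th i * x i) (m i))"
    using N by simp
  finally show ?thesis
    unfolding eval_m_bound[OF N] ABC_simps A_m
    by (simp add: scale_right_distrib sum.distrib mult.commute)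
qed

lemma eval_m_B:
  assumes "x \<in> verma_space"
  shows "eval_m (verma_B q a b c lam x) = B (eval_m x)"
proof -
  obtain N where N: "\<forall>i\<ge>N. x i = 0"
    using assms by (rule verma_spaceE)
  have "eval_m (verma_B q a b c lam x)
      = (\<Sum>i<N. sc (ts i * x i + ph (Suc i) * x (Suc i)) (m i))"
    unfolding verma_B_def using N by (intro eval_m_bound) auto
  also have "\<dots> = (\<Sum>i<N. sc (ts i * x i) (m i)) + (\<Sum>i<N. sc (ph (Suc i) * x (Suc i)) (m i))"
    by (simp only: scale_left_distrib sum.distrib)
  \<comment> \<open>The shift adds a term for \<open>i = 0\<close>, which vanishes by
    \<open>ph 0 = 0\<close>; the top term vanishes by \<open>x N = 0\<close>.\<close>
  also have "(\<Sum>i<N. sc (ph (Suc i) * x (Suc i)) (m i)) = (\<Sum>i<Suc N. sc (ph i * x i) (m (i - 1)))"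
    unfolding sum.lessThan_Suc_shift by (simp add: phi_0)
  also have "\<dots> = (\<Sum>i<N. sc (ph i * x i) (m (i - 1)))"
    using N by simp
  finally show ?thesis
    unfolding eval_m_bound[OF N] ABC_simps B_m
    by (simp add: scale_right_distrib sum.distrib mult.commute)
qed

lemma eval_m_C:
  assumes x: "x \<in> verma_space"
  shows "eval_m (verma_C q a b c lam x) = C (eval_m x)"
proof -
  note mem = verma_space_A[of _ q a b c lam] verma_space_B[of _ q a b c lam]
  have g: "verma_gamma q a b c lam = gamma"
    by (simp add: verma_gamma_def gamma_eq)
  show ?thesis
    unfolding verma_C_def g C_eq[of "eval_m x"]
    by (simp add: eval_m_diff eval_m_scale eval_m_A eval_m_B mem x verma_space_diff verma_space_scale)
qed

lemma eval_m_surj: "eval_m ` verma_space = UNIV"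
proof (rule submodule_UNIV)
  show "subspace (eval_m ` verma_space)"
  proof (rule subspaceI)
    show "0 \<in> eval_m ` verma_space"
      using eval_m_unit[of 0 0] unit_mem[of 0 0] by (metis imageI scale_zero_left)
    show "x + y \<in> eval_m ` verma_space" if "x \<in> eval_m ` verma_space" "y \<in> eval_m ` verma_space" for x y
      using that by (auto simp: eval_m_add[symmetric] intro!: imageI verma_space_add)
    show "sc t x \<in> eval_m ` verma_space" if "x \<in> eval_m ` verma_space" for t x
      using that by (auto simp: eval_m_scale[symmetric] intro!: imageI verma_space_scale)
  qed
  show "A y \<in> eval_m ` verma_space" if "y \<in> eval_m ` verma_space" for y
    using that by (auto simp: eval_m_A[symmetric] intro!: imageI verma_space_A)
  show "B y \<in> eval_m ` verma_space" if "y \<in> eval_m ` verma_space" for y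
    using that by (auto simp: eval_m_B[symmetric] intro!: imageI verma_space_B)
  show "C y \<in> eval_m ` verma_space" if y: "y \<in> eval_m ` verma_space" for y
  proof -
    obtain x where x: "x \<in> verma_space" "y = eval_m x"
      using y by blast
    have "verma_C q a b c lam x \<in> verma_space"
      unfolding verma_C_def
      by (intro verma_space_diff verma_space_scale verma_space_A verma_space_B x(1))
    then show ?thesis
      using x by (metis eval_m_C imageI)
  qed
  show "v \<in> eval_m ` verma_space"
    using eval_m_unit[of 0 1] unit_mem[of 0 1] by (metis imageI m_def raise.simps(1) scale_one)
  show "v \<noteq> 0"
    by (rule v0)
qed

lemma span_m: "span (range m) = UNIV"
proof -
  have "eval_m x \<in> span (range m)" for x
    unfolding eval_m_def by (intro span_sum span_scale span_base) auto
  then have "eval_m ` verma_space \<subseteq> span (range m)"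
    by (rule image_subsetI)
  then show ?thesis
    unfolding eval_m_surj by (rule top.extremum_uniqueI)
qed

lemma eq_on_m:
  assumes "lin S" "lin T" "\<And>i. S (m i) = T (m i)"
  shows "S x = T x"
proof -
  have "x \<in> span (range m)"
    by (simp add: span_m)
  then show ?thesis
    by (induction rule: span_induct_alt) (auto simp: lin_simps[OF assms(1)] lin_simps[OF assms(2)] assms(3))
qed

end

section \<open>Periodicity, the scalar delta and the kernel\<close>

locale periodic_verma_vector = verma_vector sc Basis q A B C v a b c lam
  for sc :: "'a::alg_closed_field \<Rightarrow> 'v::ab_group_add \<Rightarrow> 'v" and Basis q A B C v a b c lam +
  fixes d :: nat
  assumes d0: "d > 0" and qd: "q ^ (2 * d) = 1" and dim: "dim UNIV = d"
begin

text \<open>\<open>q^d\<close> is a square root of 1, so a shift by \<open>d\<close> multiplies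
  \<open>q^n\<close> and \<open>q'^n\<close> by one common sign, which cancels in theta and
  phi.\<close>

lemma q_power_shift: "\<exists>e. e * e = 1 \<and> (\<forall>n. q ^ (n + d) = e * q ^ n \<and> q' ^ (n + d) = e * q' ^ n)"
proof -
  have e: "q ^ d * q ^ d = 1"
    using qd by (simp add: power_add[symmetric] mult_2)
  then have "q' ^ d = q ^ d"
    by (metis inverse_unique power_inverse)
  then show ?thesis
    using e by (intro exI[of _ "q ^ d"]) (simp add: power_add mult.commute)
qed

lemma theta_periodic: "aw_theta q x lam (n + d) = aw_theta q x lam n"
  and phi_periodic: "ph (n + d) = ph n"
proof -
  obtain e where e: "e * e = 1" "q ^ (n + d) = e * q ^ n" "q' ^ (n + d) = e * q' ^ n"
    using q_power_shift by blast
  have e2: "(e * X)^2 = X^2" for X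
    using e(1) by (simp add: power_mult_distrib power2_eq_square[of e])
  show "aw_theta q x lam (n + d) = aw_theta q x lam n"
    unfolding theta_eq e(2,3) e2 ..
  have "(e * X - e * Y) * (x * (e * X) - y * (e * Y)) = (e * e) * ((X - Y) * (x * X - y * Y))" for X Y x y
    by (simp add: algebra_simps)
  then show "ph (n + d) = ph n"
    unfolding phi_eq e(2,3) e2 e(1) by simp
qed

lemma raise_A: "raise n (A x) = A (raise n x)"
  by (induction n) (simp_all add: ABC_simps)

text \<open>\<open>raise d\<close> commutes with \<open>A\<close>, and by periodicity
  \<open>A - th n\<close> is also the factor that leads from \<open>m (n + d)\<close> to its
  successor.\<close>

lemma raise_m: "raise d (m n) = m (n + d)"
proof (induction n)
  case (Suc n)
  have "raise d (m (Suc n)) = raise d (A (m n) - sc (th n) (m n))"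
    by (simp add: m_def)
  also have "\<dots> = A (raise d (m n)) - sc (th n) (raise d (m n))"
    by (simp add: lin_simps[OF lin_raise] raise_A)
  also have "\<dots> = m (Suc n + d)"
    unfolding Suc by (simp add: m_def theta_periodic)
  finally show ?case .
qed (simp add: m_def)

lemma raise_B: "raise d (B x) = B (raise d x)"
proof (rule eq_on_m[where S = "\<lambda>x. raise d (B x)" and T = "\<lambda>x. B (raise d x)"])
  show "lin (\<lambda>x. raise d (B x))" "lin (\<lambda>x. B (raise d x))"
    by (auto intro!: linI simp: ABC_simps lin_simps[OF lin_raise])
  fix n
  have "raise d (B (m n)) = sc (ts n) (m (n + d)) + sc (ph n) (m (n - 1 + d))"
    by (simp add: B_m lin_simps[OF lin_raise] raise_m)
  \<comment> \<open>Truncation makes the two indices differ only for \<open>n = 0\<close>, where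
    \<open>ph 0 = 0\<close>.\<close>
  also have "sc (ph n) (m (n - 1 + d)) = sc (ph n) (m (n + d - 1))"
    by (cases n) (simp_all add: phi_0)
  finally show "raise d (B (m n)) = B (raise d (m n))"
    by (simp add: raise_m B_m[of "n + d"] theta_periodic phi_periodic)
qed

text \<open>Commuting with \<open>A\<close> and \<open>B\<close>, \<open>raise d\<close> also
  commutes with \<open>C\<close> by \<open>C_eq\<close>, so Schur's lemma applies.\<close>

lemma raise_scalar: "\<exists>\<delta>. \<forall>n. m (n + d) = sc \<delta> (m n)"
proof -
  have "raise d (C x) = C (raise d x)" for x
    unfolding C_eq[of x] C_eq[of "raise d x"]
    by (simp add: lin_simps[OF lin_raise] raise_A raise_B)
  then obtain \<delta> where "\<forall>x. raise d x = sc \<delta> x"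
    using schur[OF lin_raise] raise_A raise_B by blast
  then show ?thesis
    using raise_m by metis
qed

text \<open>By periodicity up to a scalar, the first \<open>d\<close> vectors already span V, whose
  dimension is \<open>d\<close>.\<close>

lemma m_independent:
  assumes "(\<Sum>i<d. sc (x i) (m i)) = 0" "i < d"
  shows "x i = 0"
proof -
  let ?M = "m ` {..<d}"
  obtain \<delta> where \<delta>: "\<And>n. m (n + d) = sc \<delta> (m n)"
    using raise_scalar by blast
  have "m n \<in> span ?M" for n
  proof (induction n rule: less_induct)
    case (less n)
    show ?case
    proof (cases "n < d")
      case True
      then show ?thesis by (auto intro: span_base)
    next
      case False
      then have "m n = sc \<delta> (m (n - d))"
        using \<delta>[of "n - d"] by simp
      then show ?thesis
        using less[of "n - d"] False d0 by (simp add: span_scale)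
    qed
  qed
  then have "span (range m) \<subseteq> span ?M"
    by (intro span_minimal) auto
  then have sp: "UNIV \<subseteq> span ?M"
    by (simp add: span_m)
  \<comment> \<open>A spanning set has at least \<open>d\<close> elements, so the first
    \<open>d\<close> vectors are distinct.\<close>
  have "d \<le> card ?M"
    using span_card_ge_dim[OF _ sp] dim by simp
  then have card: "card ?M = d"
    using card_image_le[of "{..<d}" m] by simp
  then have inj: "inj_on m {..<d}"
    by (intro eq_card_imp_inj_on) auto
  have ind: "independent ?M"
    using card_le_dim_spanning[OF _ sp] dim card by simp
  define u where "u = (\<lambda>y. x (the_inv_into {..<d} m y))"
  have u: "u (m j) = x j" if "j < d" for j
    using that inj by (simp add: u_def the_inv_into_f_f)
  have "(\<Sum>y\<in>?M. sc (u y) y) = 0"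
    using assms(1) u by (simp add: sum.reindex[OF inj])
  then have "u (m i) = 0"
    using ind assms(2) by (intro independentD[OF ind, of ?M u]) auto
  then show ?thesis
    using u assms(2) by simp
qed

lemma eval_m_O_generator:
  assumes "\<And>n. m (n + d) = sc \<delta> (m n)"
  shows "eval_m (\<lambda>j. t * ((if j = i then \<delta> else 0) - (if j = d + i then 1 else 0))) = 0"
    and "(\<lambda>j. t * ((if j = i then \<delta> else 0) - (if j = d + i then 1 else 0))) \<in> verma_space"
proof -
  have "eval_m (\<lambda>j. t * ((if j = i then \<delta> else 0) - (if j = d + i then 1 else 0)))
      = sc t (sc \<delta> (m i) - sc 1 (m (d + i)))"
    by (simp only: eval_m_scale eval_m_diff unit_mem verma_space_diff eval_m_unit)
  then show "eval_m (\<lambda>j. t * ((if j = i then \<delta> else 0) - (if j = d + i then 1 else 0))) = 0"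
    using assms[of i] by (simp add: add.commute)
  show "(\<lambda>j. t * ((if j = i then \<delta> else 0) - (if j = d + i then 1 else 0))) \<in> verma_space"
    by (intro verma_space_scale verma_space_diff unit_mem)
qed

text \<open>A kernel element is reduced modulo O by shortening its support. Once the support lies
  below \<open>d\<close>, independence makes it zero.\<close>

lemma eval_m_kernel:
  assumes \<delta>: "\<And>n. m (n + d) = sc \<delta> (m n)"
  shows "{x \<in> verma_space. eval_m x = 0} = verma_O d \<delta>"
proof (intro equalityI subsetI)
  fix x assume x: "x \<in> verma_O d \<delta>"
  obtain N k where xk: "x = (\<lambda>j. \<Sum>i<N. k i * ((if j = i then \<delta> else 0) - (if j = d + i then 1 else 0)))"
    using x by (auto simp: verma_O_def)
  have "(\<lambda>j. \<Sum>i<N. k i * ((if j = i then \<delta> else 0) - (if j = d + i then 1 else 0))) \<in> verma_space \<and>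
    eval_m (\<lambda>j. \<Sum>i<N. k i * ((if j = i then \<delta> else 0) - (if j = d + i then 1 else 0))) = 0" for N
  proof (induction N)
    case 0
    show ?case
      using eval_m_unit[of 0 0] unit_mem[of 0 0] by simp
  next
    case (Suc N)
    then show ?case
      unfolding sum.lessThan_Suc
      using eval_m_O_generator[OF \<delta>, of "k N" N] by (simp only: eval_m_add verma_space_add) simp
  qed
  then show "x \<in> {x \<in> verma_space. eval_m x = 0}"
    unfolding xk by blast
next
  fix x assume "x \<in> {x \<in> verma_space. eval_m x = 0}"
  then obtain N where "\<forall>i\<ge>N. x i = 0" "eval_m x = 0"
    by (auto elim: verma_spaceE)
  then show "x \<in> verma_O d \<delta>"
  proof (induction N arbitrary: x)
    case 0
    then have "x = (\<lambda>j. 0)" by auto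
    then show ?case
      using verma_O_zero by simp
  next
    case (Suc N)
    show ?case
    proof (cases "N < d")
      case True
      then have z: "\<forall>i\<ge>d. x i = 0"
        using Suc.prems(1) by auto
      then have "(\<Sum>i<d. sc (x i) (m i)) = 0"
        using Suc.prems(2) eval_m_bound by metis
      then have "x i = 0" for i
        using m_independent[of x i] z by (cases "i < d") auto
      then have "x = (\<lambda>j. 0)" by auto
      then show ?thesis
        using verma_O_zero by simp
    next
      case False
      define t where "t = x N"
      \<comment> \<open>The generator with index \<open>N - d\<close> has entry \<open>-1\<close> at
        \<open>N\<close>, so adding \<open>x N\<close> times it clears the top entry of
        \<open>x\<close>.\<close>
      define g where "g = (\<lambda>j. t * ((if j = N - d then \<delta> else 0) - (if j = d + (N - d) then 1 else 0)))"
      have g: "g \<in> verma_space" "eval_m g = 0"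
        unfolding g_def using eval_m_O_generator[OF \<delta>] by blast+
      have xs: "x \<in> verma_space"
        using Suc.prems(1) by (auto simp: verma_space_iff)
      have "\<forall>i\<ge>N. x i + g i = 0"
      proof (intro allI impI)
        fix i assume "N \<le> i"
        then show "x i + g i = 0"
          using Suc.prems(1) False d0 by (cases "i = N") (auto simp: g_def t_def)
      qed
      moreover have "eval_m (\<lambda>i. x i + g i) = 0"
        using Suc.prems(2) g xs by (simp add: eval_m_add)
      ultimately have "(\<lambda>i. x i + g i) \<in> verma_O d \<delta>"
        by (rule Suc.IH)
      from verma_O_add[OF this, of "- t" "N - d"]
      show ?thesis
        by (simp add: g_def)
    qed
  qed
qed

lemma W_isomorphic: "\<exists>\<delta>. W_iso sc q d A B C a b c lam \<delta>"
proof -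
  obtain \<delta> where \<delta>: "\<And>n. m (n + d) = sc \<delta> (m n)"
    using raise_scalar by blast
  show ?thesis
    unfolding W_iso_def
    by (intro exI[of _ \<delta>] exI[of _ eval_m] conjI ballI allI eval_m_add eval_m_scale
        eval_m_A eval_m_B eval_m_C eval_m_surj eval_m_kernel[OF \<delta>])
qed

end

theorem theorem1p9:
  fixes q :: "'a::alg_closed_field"
    and d d' :: nat
    and sc :: "'a \<Rightarrow> 'v::ab_group_add \<Rightarrow> 'v"
    and A B C :: "'v \<Rightarrow> 'v"
  assumes q_ord: "0 < d" "q ^ d = 1" "\<forall>k. 0 < k \<and> k < d \<longrightarrow> q ^ k \<noteq> 1"
    and d_ok: "d \<notin> {1, 2, 4}"
    and d'_def: "d' = (if odd d then d else d div 2)"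
    and V_mod: "aw_module sc q A B C"
    and V_dim: "vector_space.dim sc (UNIV :: 'v set) = d'"
    and V_irr: "aw_irreducible sc A B C"
    and V_marg: "\<exists>\<mu>. aw_marginal_weight sc q A B \<mu>"
  shows "\<exists>a b c lam \<delta>. a \<noteq> 0 \<and> b \<noteq> 0 \<and> c \<noteq> 0 \<and> lam \<noteq> 0 \<and>
           W_iso sc q d' A B C a b c lam \<delta>"
proof -
  interpret vs: vector_space sc
    using V_mod by (simp add: aw_module_def)
  have d3: "d > 2"
  proof -
    have "d \<noteq> 0" "d \<noteq> 1" "d \<noteq> 2"
      using q_ord(1) d_ok by auto
    then show ?thesis by linarith
  qed
  have d'0: "d' > 0"
    using d3 by (auto simp: d'_def)
  have q0: "q \<noteq> 0"
    using q_ord d3 by (metis power_0_left zero_neq_one gr_implies_not0)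
  \<comment> \<open>The order \<open>d\<close> exceeds 2 and is not 4, so it does not divide
    4.\<close>
  have q4: "q ^ 4 \<noteq> 1"
  proof (cases "d = 3")
    case True
    have "q ^ 4 = q ^ 3 * q ^ 1"
      by (simp add: power4_eq_xxxx power3_eq_cube)
    then show ?thesis
      using q_ord True by (auto dest: spec[of _ 1])
  next
    case False
    then have "4 < d"
      using d3 d_ok by auto
    then show ?thesis
      using q_ord by simp
  qed
  have qd': "q ^ (2 * d') = 1"
  proof (cases "odd d")
    case True
    then show ?thesis
      using q_ord(2) by (simp add: d'_def mult_2 power_add)
  next
    case False
    then show ?thesis
      using q_ord(2) by (simp add: d'_def)
  qed
  obtain Basis where Basis: "vs.independent Basis" "vs.span Basis = UNIV" "card Basis = d'"
  proof -
    obtain Bs where "Bs \<subseteq> UNIV" "vs.independent Bs" "UNIV \<subseteq> vs.span Bs" "card Bs = vs.dim UNIV"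
      using vs.basis_exists[of UNIV] by metis
    then show ?thesis
      using that V_dim by blast
  qed
  \<comment> \<open>Infinite sets have cardinality 0 by convention, so \<open>d' > 0\<close> gives
    finiteness.\<close>
  have "finite Basis"
    using Basis(3) d'0 by (metis card.infinite less_irrefl)
  then interpret irreducible_aw_module sc Basis q A B C
    using Basis q0 q4 V_mod V_irr by unfold_locales auto
  obtain mu where mu: "aw_marginal_weight sc q A B mu"
    using V_marg by blast
  then have mu0: "mu * inverse mu = 1"
    by (simp add: aw_marginal_weight_def)
  obtain v k where v: "v \<noteq> 0" "B v = sc (mu + inverse mu) v"
    "B (A v) = sc (mu * q^2 + inverse mu * q'^2) (A v) + sc k v"
    "k * (mu + inverse mu - mu * q'^2 - inverse mu * q^2)
      = (q - q')^2 * ((q + q') * alpha - gamma * (mu + inverse mu))"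
    using marginal_vector_exists[OF mu] by blast
  \<comment> \<open>These parameters give \<open>beta\<close>, \<open>gamma\<close> and
    \<open>k\<close> the values they have in the Verma module with
    \<open>lam = b / mu\<close>.\<close>
  obtain a a' b b' c c' where par: "a * a' = 1" "b * b' = 1" "c * c' = 1"
    "beta = (c + c') * (a + a') + (b + b') * (b * inverse mu * q + b' * mu * q')"
    "gamma = (a + a') * (b + b') + (c + c') * (b * inverse mu * q + b' * mu * q')"
    "k = (a * b' * mu + a' * b * inverse mu) * (mu + inverse mu - mu * q^2 - inverse mu * q'^2) +
      (q - q') * (b' * mu - b * inverse mu) * (q' * inverse mu * a' - (c + c') + q * a * mu)"
    using verma_parameters_exist[OF qq' q_plus_minus mu0 v(4), of beta] by blast
  have inv: "a' = inverse a" "b' = inverse b" "c' = inverse c"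
    using par(1-3) by (metis inverse_unique)+
  have nz: "a \<noteq> 0" "b \<noteq> 0" "c \<noteq> 0" "mu \<noteq> 0"
    using par(1-3) mu0 by auto
  \<comment> \<open>This makes the zeroth dual theta equal to \<open>mu + 1/mu\<close>, so that
    \<open>v\<close> can serve as \<open>m_0\<close>.\<close>
  define lam where "lam = b * inverse mu"
  have lam: "lam \<noteq> 0" "inverse lam = b' * mu"
    using nz by (simp_all add: lam_def inv)
  have ts: "aw_theta q b lam 0 = mu + inverse mu" "aw_theta q b lam 1 = mu * q^2 + inverse mu * q'^2"
    using nz by (simp_all add: aw_theta_def lam inv lam_def power_inverse field_simps power2_eq_square)
  have th: "aw_theta q a lam 0 = a * b' * mu + a' * b * inverse mu"
    by (simp add: aw_theta_def lam inv lam_def mult_ac)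
  have ph: "aw_phi q a b c lam 1 = (q - q') * (b' * mu - b * inverse mu) * (q' * inverse mu * a' - (c + c') + q * a * mu)"
    using nz q0 by (simp add: aw_phi_def lam inv lam_def field_simps)
  interpret periodic_verma_vector sc Basis q A B C v a b c lam d'
  proof
    show "a \<noteq> 0" "b \<noteq> 0" "c \<noteq> 0" "lam \<noteq> 0" "v \<noteq> 0" "0 < d'" "q ^ (2 * d') = 1" "vs.dim UNIV = d'"
      using nz lam v d'0 qd' V_dim by simp_all
    show "beta = (c + inverse c) * (a + inverse a) + (b + inverse b) * (lam * q + inverse lam * inverse q)"
      "gamma = (a + inverse a) * (b + inverse b) + (c + inverse c) * (lam * q + inverse lam * inverse q)"
      using par(4,5) unfolding lam(2) by (simp_all only: inv lam_def)
    show "B v = sc (aw_theta q b lam 0) v"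
      using v ts by simp
    have "k = aw_theta q a lam 0 * (aw_theta q b lam 0 - aw_theta q b lam 1) + aw_phi q a b c lam 1"
      unfolding par(6) ts th ph by (simp add: diff_diff_eq)
    then show "B (A v) = sc (aw_theta q b lam 1) (A v) +
      sc (aw_theta q a lam 0 * (aw_theta q b lam 0 - aw_theta q b lam 1) + aw_phi q a b c lam 1) v"
      using v(3) ts by simp
  qed
  show ?thesis
    using W_isomorphic nz lam by blast
qed

end
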